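(* Let $R$ be a commutative ring, $I$ an ideal of $R$, $M$ a free $R$-module of rank $n\ge2$, and $N=R\oplus M$. Then, identifying $\mathrm{Aut}(N)$ with $\mathrm{GL}_{n+1}(R)$ by means of a basis of $M$, $$\mathrm{ETrans}(N,IN)=\mathrm{Trans}(N,IN)=\mathrm{E}_{n+1}(R,I).$$
   Context: $M^*=\mathrm{Hom}_R(M,R)$. An element $q$ of a module $M$ is unimodular if $\phi(q)=1$ for some $\phi\in M^*$; $\mathrm{Um}(M)$ is the set of unimodular elements. For a finitely generated module $N$, a transvection of $N$ is an automorphism $1+\pi_q$, where $\pi_q(p)=\pi(p)q$, $q\in N$, $\pi\in N^*$, $\pi(q)=0$, and either $q\in\mathrm{Um}(N)$ or $\pi\in\mathrm{Um}(N^* )$. $\mathrm{Trans}(N,IN)$ is the group generated by the transvections $1+\pi_q$ with either $q\in IN$ or $\pi\in IN^*$. For $N=R\oplus M$, the elementary transvections are $E_x:(a,p)\mapsto(a,p+ax)$ ($x\in M$) and $E^*_\tau:(a,p)\mapsto(a+\tau(p),p)$ ($\tau\in M^*$). $\mathrm{ETrans}(N)$ is the group they generate; $\mathrm{ETrans}(IN)$ is the subgroup generated by the $E_x,E^*_\tau$ with $x\in IM$, $\tau\in IM^*$; $\mathrm{ETrans}(N,IN)$ is the normal closure of $\mathrm{ETrans}(IN)$ in $\mathrm{ETrans}(N)$. $\mathrm{E}_k(R)$ is the subgroup of $\mathrm{SL}_k(R)$ generated by the matrices $I_k+\lambda e_{ij}$ ($i\neq j$, $\lambda\in R$); $\mathrm{E}_k(R,I)$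 is the normal closure in $\mathrm{E}_k(R)$ of the subgroup generated by those with $\lambda\in I$. Elements of $N\cong R^{n+1}$ are row vectors and matrices act on the right. *)

theory Defs
  imports
    "HOL-Algebra.Bij"
    "HOL-Algebra.Generated_Groups"
    "HOL-Algebra.Ideal"
    "Jordan_Normal_Form.Matrix"
begin

section \<open>Modules\<close>

text \<open>The fields \<open>mult\<close> and \<open>one\<close> of a module record play no role for modules; they are left
  unspecified where there is no natural value.\<close>

definition regular_module :: "('a, 'm) ring_scheme \<Rightarrow> ('a, 'a) module" where
  "regular_module R =
    \<lparr>carrier = carrier R, monoid.mult = monoid.mult R, one = one R,
     zero = zero R, add = add R, module.smult = monoid.mult R\<rparr>"

definition direct_sum ::
  "('a, 'b, 'm) module_scheme \<Rightarrow> ('a, 'c, 'n) module_scheme \<Rightarrow> ('a, 'b \<times> 'c) module" where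
  "direct_sum M N =
    \<lparr>carrier = carrier M \<times> carrier N, monoid.mult = undefined, one = undefined,
     zero = (\<zero>\<^bsub>M\<^esub>, \<zero>\<^bsub>N\<^esub>),
     add = (\<lambda>u v. (fst u \<oplus>\<^bsub>M\<^esub> fst v, snd u \<oplus>\<^bsub>N\<^esub> snd v)),
     module.smult = (\<lambda>a u. (a \<odot>\<^bsub>M\<^esub> fst u, a \<odot>\<^bsub>N\<^esub> snd u))\<rparr>"

text \<open>Linear maps are extensional on the carrier, so that equality of functions is equality of
  linear maps.\<close>

definition lin_hom ::
  "('a, 'r) ring_scheme \<Rightarrow> ('a, 'b, 'm) module_scheme \<Rightarrow> ('a, 'c, 'n) module_scheme
    \<Rightarrow> ('b \<Rightarrow> 'c) set" where
  "lin_hom R M N =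
    {f \<in> carrier M \<rightarrow>\<^sub>E carrier N.
      (\<forall>x\<in>carrier M. \<forall>y\<in>carrier M. f (x \<oplus>\<^bsub>M\<^esub> y) = f x \<oplus>\<^bsub>N\<^esub> f y) \<and>
      (\<forall>a\<in>carrier R. \<forall>x\<in>carrier M. f (a \<odot>\<^bsub>M\<^esub> x) = a \<odot>\<^bsub>N\<^esub> f x)}"

definition dual :: "('a, 'r) ring_scheme \<Rightarrow> ('a, 'b, 'm) module_scheme \<Rightarrow> ('a, 'b \<Rightarrow> 'a) module" where
  "dual R M =
    \<lparr>carrier = lin_hom R M (regular_module R), monoid.mult = undefined, one = undefined,
     zero = (\<lambda>x\<in>carrier M. \<zero>\<^bsub>R\<^esub>),
     add = (\<lambda>f g. \<lambda>x\<in>carrier M. f x \<oplus>\<^bsub>R\<^esub> g x),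
     module.smult = (\<lambda>a f. \<lambda>x\<in>carrier M. a \<otimes>\<^bsub>R\<^esub> f x)\<rparr>"

definition Um :: "('a, 'r) ring_scheme \<Rightarrow> ('a, 'b, 'm) module_scheme \<Rightarrow> 'b set" where
  "Um R M = {q \<in> carrier M. \<exists>\<phi>\<in>carrier (dual R M). \<phi> q = \<one>\<^bsub>R\<^esub>}"

text \<open>The submodule \<open>IM\<close>: as \<open>I\<close> is an ideal, it is the additive subgroup generated by the
  products \<open>a m\<close>.\<close>

definition ideal_smult :: "'a set \<Rightarrow> ('a, 'b, 'm) module_scheme \<Rightarrow> 'b set" where
  "ideal_smult I M = generate (add_monoid M) {a \<odot>\<^bsub>M\<^esub> x | a x. a \<in> I \<and> x \<in> carrier M}"

definition free_basis ::
  "('a, 'r) ring_scheme \<Rightarrow> ('a, 'b, 'm) module_scheme \<Rightarrow> nat \<Rightarrow> (nat \<Rightarrow> 'b) \<Rightarrow> bool" where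
  "free_basis R M n b \<longleftrightarrow>
    b \<in> {..<n} \<rightarrow> carrier M \<and>
    (\<forall>x\<in>carrier M. \<exists>!c. c \<in> {..<n} \<rightarrow>\<^sub>E carrier R \<and> x = (\<Oplus>\<^bsub>M\<^esub> i\<in>{..<n}. c i \<odot>\<^bsub>M\<^esub> b i))"

definition coords ::
  "('a, 'r) ring_scheme \<Rightarrow> ('a, 'b, 'm) module_scheme \<Rightarrow> nat \<Rightarrow> (nat \<Rightarrow> 'b) \<Rightarrow> 'b \<Rightarrow> nat \<Rightarrow> 'a" where
  "coords R M n b x =
    (THE c. c \<in> {..<n} \<rightarrow>\<^sub>E carrier R \<and> x = (\<Oplus>\<^bsub>M\<^esub> i\<in>{..<n}. c i \<odot>\<^bsub>M\<^esub> b i))"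

definition Aut :: "('a, 'r) ring_scheme \<Rightarrow> ('a, 'b, 'm) module_scheme \<Rightarrow> ('b \<Rightarrow> 'b) monoid" where
  "Aut R M = BijGroup (carrier M) \<lparr>carrier := lin_hom R M M \<inter> Bij (carrier M)\<rparr>"

definition normal_closure :: "('g, 'm) monoid_scheme \<Rightarrow> 'g set \<Rightarrow> 'g set" where
  "normal_closure G H = (\<lambda>K. K \<lhd> G) hull H"


section \<open>Transvections\<close>

definition transvection ::
  "('a, 'b, 'm) module_scheme \<Rightarrow> ('b \<Rightarrow> 'a) \<Rightarrow> 'b \<Rightarrow> 'b \<Rightarrow> 'b" where
  "transvection N \<pi> q = (\<lambda>p\<in>carrier N. p \<oplus>\<^bsub>N\<^esub> \<pi> p \<odot>\<^bsub>N\<^esub> q)"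

definition transvection_data ::
  "('a, 'r) ring_scheme \<Rightarrow> ('a, 'b, 'm) module_scheme \<Rightarrow> (('b \<Rightarrow> 'a) \<times> 'b) set" where
  "transvection_data R N =
    {(\<pi>, q). \<pi> \<in> carrier (dual R N) \<and> q \<in> carrier N \<and> \<pi> q = \<zero>\<^bsub>R\<^esub> \<and>
      (q \<in> Um R N \<or> \<pi> \<in> Um R (dual R N))}"

definition Trans ::
  "('a, 'r) ring_scheme \<Rightarrow> 'a set \<Rightarrow> ('a, 'b, 'm) module_scheme \<Rightarrow> ('b \<Rightarrow> 'b) set" where
  "Trans R I N =
    generate (Aut R N)
      {transvection N \<pi> q | \<pi> q. (\<pi>, q) \<in> transvection_data R N \<and>
        (q \<in> ideal_smult I N \<or> \<pi> \<in> ideal_smult I (dual R N))}"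


section \<open>Elementary transvections of \<open>R \<oplus> M\<close>\<close>

definition ring_plus ::
  "('a, 'r) ring_scheme \<Rightarrow> ('a, 'b, 'm) module_scheme \<Rightarrow> ('a, 'a \<times> 'b) module" where
  "ring_plus R M = direct_sum (regular_module R) M"

definition elem_trans ::
  "('a, 'r) ring_scheme \<Rightarrow> ('a, 'b, 'm) module_scheme \<Rightarrow> 'b \<Rightarrow> 'a \<times> 'b \<Rightarrow> 'a \<times> 'b" where
  "elem_trans R M x = (\<lambda>(a, p)\<in>carrier (ring_plus R M). (a, p \<oplus>\<^bsub>M\<^esub> a \<odot>\<^bsub>M\<^esub> x))"

definition elem_trans_dual ::
  "('a, 'r) ring_scheme \<Rightarrow> ('a, 'b, 'm) module_scheme \<Rightarrow> ('b \<Rightarrow> 'a) \<Rightarrow> 'a \<times> 'b \<Rightarrow> 'a \<times> 'b" where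
  "elem_trans_dual R M \<tau> = (\<lambda>(a, p)\<in>carrier (ring_plus R M). (a \<oplus>\<^bsub>R\<^esub> \<tau> p, p))"

text \<open>\<open>ETrans R M\<close> is the group written \<open>ETrans(N)\<close> for \<open>N = R \<oplus> M\<close>, \<open>ETrans_gen R I M\<close> is
  \<open>ETrans(IN)\<close> and \<open>ETrans_rel R I M\<close> is \<open>ETrans(N, IN)\<close>.\<close>

definition ETrans ::
  "('a, 'r) ring_scheme \<Rightarrow> ('a, 'b, 'm) module_scheme \<Rightarrow> ('a \<times> 'b \<Rightarrow> 'a \<times> 'b) monoid" where
  "ETrans R M =
    (Aut R (ring_plus R M)) \<lparr>carrier :=
      generate (Aut R (ring_plus R M))
        (elem_trans R M ` carrier M \<union> elem_trans_dual R M ` carrier (dual R M))\<rparr>"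

definition ETrans_gen ::
  "('a, 'r) ring_scheme \<Rightarrow> 'a set \<Rightarrow> ('a, 'b, 'm) module_scheme \<Rightarrow> ('a \<times> 'b \<Rightarrow> 'a \<times> 'b) set" where
  "ETrans_gen R I M =
    generate (ETrans R M)
      (elem_trans R M ` ideal_smult I M \<union> elem_trans_dual R M ` ideal_smult I (dual R M))"

definition ETrans_rel ::
  "('a, 'r) ring_scheme \<Rightarrow> 'a set \<Rightarrow> ('a, 'b, 'm) module_scheme \<Rightarrow> ('a \<times> 'b \<Rightarrow> 'a \<times> 'b) set" where
  "ETrans_rel R I M = normal_closure (ETrans R M) (ETrans_gen R I M)"


section \<open>Matrices over \<open>R\<close>\<close>

definition mat_monoid :: "('a, 'r) ring_scheme \<Rightarrow> nat \<Rightarrow> 'a mat monoid" where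
  "mat_monoid R k =
    \<lparr>carrier = {A \<in> carrier_mat k k. elements_mat A \<subseteq> carrier R},
     monoid.mult = (\<lambda>A B. mat k k (\<lambda>(i, j). \<Oplus>\<^bsub>R\<^esub> l\<in>{..<k}. A $$ (i, l) \<otimes>\<^bsub>R\<^esub> B $$ (l, j))),
     one = mat k k (\<lambda>(i, j). if i = j then \<one>\<^bsub>R\<^esub> else \<zero>\<^bsub>R\<^esub>)\<rparr>"

definition GL :: "('a, 'r) ring_scheme \<Rightarrow> nat \<Rightarrow> 'a mat monoid" where
  "GL R k = units_of (mat_monoid R k)"

definition elem_mat :: "('a, 'r) ring_scheme \<Rightarrow> nat \<Rightarrow> nat \<Rightarrow> nat \<Rightarrow> 'a \<Rightarrow> 'a mat" where
  "elem_mat R k i j a =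
    mat k k (\<lambda>(r, s). (if r = s then \<one>\<^bsub>R\<^esub> else \<zero>\<^bsub>R\<^esub>) \<oplus>\<^bsub>R\<^esub> (if r = i \<and> s = j then a else \<zero>\<^bsub>R\<^esub>))"

definition elem_mats :: "('a, 'r) ring_scheme \<Rightarrow> nat \<Rightarrow> 'a set \<Rightarrow> 'a mat set" where
  "elem_mats R k L = {elem_mat R k i j a | i j a. i < k \<and> j < k \<and> i \<noteq> j \<and> a \<in> L}"

text \<open>Elementary matrices have determinant 1, so the subgroup they generate in \<open>GL R k\<close> is the
  subgroup they generate in the special linear group.\<close>

definition Elem :: "('a, 'r) ring_scheme \<Rightarrow> nat \<Rightarrow> 'a mat monoid" where
  "Elem R k = (GL R k) \<lparr>carrier := generate (GL R k) (elem_mats R k (carrier R))\<rparr>"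

definition Elem_rel :: "('a, 'r) ring_scheme \<Rightarrow> 'a set \<Rightarrow> nat \<Rightarrow> 'a mat set" where
  "Elem_rel R I k = normal_closure (Elem R k) (generate (Elem R k) (elem_mats R k I))"


section \<open>The matrix of an endomorphism\<close>

text \<open>Elements are row vectors and matrices act on the right: row \<open>i\<close> consists of the coordinates
  of the image of the \<open>i\<close>-th basis vector. With the function composition of \<open>Aut\<close>, passing to
  matrices reverses products, which does not affect generated subgroups and normal closures.\<close>

definition matrix_of ::
  "('a, 'r) ring_scheme \<Rightarrow> ('a, 'b, 'm) module_scheme \<Rightarrow> nat \<Rightarrow> (nat \<Rightarrow> 'b) \<Rightarrow> ('b \<Rightarrow> 'b) \<Rightarrow> 'a mat"
  where "matrix_of R M k b f = mat k k (\<lambda>(i, j). coords R M k b (f (b i)) j)"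

definition ring_plus_basis ::
  "('a, 'r) ring_scheme \<Rightarrow> ('a, 'b, 'm) module_scheme \<Rightarrow> (nat \<Rightarrow> 'b) \<Rightarrow> nat \<Rightarrow> 'a \<times> 'b" where
  "ring_plus_basis R M b = case_nat (\<one>\<^bsub>R\<^esub>, \<zero>\<^bsub>M\<^esub>) (\<lambda>i. (\<zero>\<^bsub>R\<^esub>, b i))"

end

theory Submission
  imports Defs
begin

text \<open>All three groups are compared with a fourth one, \<open>E(N, I)\<close>, which lives in \<open>Aut N\<close> and makes sense
  for any free module \<open>N\<close> with a basis \<open>b 0, ..., b (k - 1)\<close> and coordinate functionals \<open>x 0, ..., x (k - 1)\<close>:
  the normal closure of the transvections \<open>p \<mapsto> p + a (x i) p (b j)\<close> with \<open>i \<noteq> j\<close> and \<open>a \<in> I\<close>, taken in the group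
  that these transvections generate when \<open>a\<close> ranges over all of \<open>R\<close>. The matrix of such a transvection is an
  elementary matrix.

  \<^bold>\<open>Transvections.\<close> Write \<open>T f q\<close> for \<open>1 + f_q\<close>. It is additive in \<open>f\<close> for fixed \<open>q\<close> and in \<open>q\<close> for fixed \<open>f\<close>,
  as long as the functionals involved kill the vectors involved, and it satisfies the commutator relation
  \<open>[T s u, T t e] = T (s e t) u\<close> whenever \<open>t\<close> kills \<open>u\<close> and \<open>e\<close>, and \<open>s\<close> kills \<open>u\<close>. Let \<open>v\<close> be a
  functional with values in \<open>I\<close> that kills a unimodular vector \<open>q\<close>, say \<open>f q = 1\<close>. Then \<open>v\<close> is a combination,
  with coefficients \<open>v_i f_j \<in> I\<close>, of the Koszul relations \<open>q_j x_i - q_i x_j\<close>, so one may assume that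
  \<open>v = a (q_j x_i - q_i x_j)\<close>. Now split \<open>q\<close> into \<open>u = q_i b_i + q_j b_j\<close> and its other components. The
  other components contribute products of generators, and for \<open>u\<close> a third index \<open>l\<close>, available because
  \<open>k \<ge> 3\<close>, exhibits \<open>T v u\<close> as the commutator of \<open>T (a x_l) u\<close>, a product of generators with coefficients
  in \<open>I\<close>, and \<open>T (q_j x_i - q_i x_j) b_l\<close>, a product of generators. The argument is symmetric in vectors and
  functionals, which settles the case of a unimodular functional as well; so \<open>Trans(N, IN) \<subseteq> E(N, I)\<close>
  (\<open>koszul_relation_mem\<close>, \<open>unimodular_right\<close>, \<open>unimodular_left\<close>). The reverse inclusion holds because a conjugate of a
  transvection by any automorphism is again a transvection of the same kind (\<open>Trans_eq_relative_elementary\<close>).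

  \<^bold>\<open>Matrices.\<close> Passing to the matrix of the inverse is an isomorphism from \<open>Aut N\<close> onto the general linear
  group, and isomorphisms carry normal closures to normal closures (\<open>to_mat_relative_elementary\<close>).

  \<^bold>\<open>Elementary transvections.\<close> For \<open>N = R \<oplus> M\<close> the maps \<open>E_x\<close> and \<open>E*_\<tau>\<close> are the transvections
  \<open>T (x 0) (0, x)\<close> and \<open>T (0, \<tau>) (b 0)\<close>. By additivity they are products of generators of \<open>E(N, I)\<close>; conversely, a generator between
  two basis vectors of \<open>M\<close> is a commutator of one \<open>E_x\<close> and one \<open>E*_\<tau>\<close> (\<open>ETrans_rel_eq\<close>).\<close>

section \<open>Normal closures inside generated subgroups\<close>

text \<open>The common shape of \<open>ETrans(N, IN)\<close>, \<open>E_k(R, I)\<close> and \<open>E(N, I)\<close>: \<open>T\<close> is the set of all generators and \<open>S\<close>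
  the set of those with coefficients in the ideal. Subgroups are formed by restricting the carrier, so that the
  unfolded definitions of the first two groups are literally instances.\<close>

definition relative_closure :: "('g, 'm) monoid_scheme \<Rightarrow> 'g set \<Rightarrow> 'g set \<Rightarrow> 'g set" where
  "relative_closure G T S =
    normal_closure (G\<lparr>carrier := generate G T\<rparr>) (generate (G\<lparr>carrier := generate G T\<rparr>) S)"

context group
begin

lemma normal_closure_normal:
  assumes "S \<subseteq> carrier G"
  shows "normal_closure G S \<lhd> G"
proof (rule normal_invI)
  let ?A = "{K. K \<lhd> G \<and> S \<subseteq> K}"
  have ne: "carrier G \<in> ?A"
    using assms normal_self by simp
  show "subgroup (normal_closure G S) G"
    unfolding normal_closure_def hull_def
    by (rule subgroups_Inter) (use ne normal_imp_subgroup in blast)+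
  show "x \<otimes> h \<otimes> inv x \<in> normal_closure G S"
    if "x \<in> carrier G" "h \<in> normal_closure G S" for x h
    using that unfolding normal_closure_def hull_def by (auto intro: normal_invE(2))
qed

text \<open>Replaces operations of the restricted group by those of \<open>G\<close>, so that the intermediate group can be forgotten.\<close>

lemma normal_subgroup_carrier_iff:
  assumes "subgroup K G"
  shows "H \<lhd> G\<lparr>carrier := K\<rparr> \<longleftrightarrow>
    subgroup H G \<and> H \<subseteq> K \<and> (\<forall>g\<in>K. \<forall>h\<in>H. g \<otimes> h \<otimes> inv g \<in> H)"
proof -
  interpret K: group "G\<lparr>carrier := K\<rparr>"
    using assms by (rule subgroup_imp_group)
  have "subgroup H (G\<lparr>carrier := K\<rparr>) \<longleftrightarrow> subgroup H G \<and> H \<subseteq> K"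
  proof
    assume H: "subgroup H (G\<lparr>carrier := K\<rparr>)"
    then show "subgroup H G \<and> H \<subseteq> K"
      using incl_subgroup[OF assms H] subgroup.subset[OF H] by simp
  next
    assume "subgroup H G \<and> H \<subseteq> K"
    then show "subgroup H (G\<lparr>carrier := K\<rparr>)"
      using assms by (intro subgroup_incl) auto
  qed
  moreover have "inv\<^bsub>G\<lparr>carrier := K\<rparr>\<^esub> g = inv g" if "g \<in> K" for g
    using m_inv_consistent[OF assms that] .
  ultimately show ?thesis
    by (simp add: K.normal_inv_iff cong: conj_cong)
qed

context
  fixes T S
  assumes T: "T \<subseteq> carrier G" and S: "S \<subseteq> generate G T"
begin

lemma relative_closure_normal: "relative_closure G T S \<lhd> G\<lparr>carrier := generate G T\<rparr>"
proof -
  interpret K: group "G\<lparr>carrier := generate G T\<rparr>"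
    by (rule subgroup_imp_group[OF generate_is_subgroup[OF T]])
  show ?thesis
    unfolding relative_closure_def
    using K.generate_incl[of S] S by (intro K.normal_closure_normal) auto
qed

lemma relative_closure_subgroup: "subgroup (relative_closure G T S) G"
  and relative_closure_subset: "relative_closure G T S \<subseteq> generate G T"
  and relative_closure_conj:
    "g \<in> generate G T \<Longrightarrow> h \<in> relative_closure G T S \<Longrightarrow> g \<otimes> h \<otimes> inv g \<in> relative_closure G T S"
  using relative_closure_normal
  unfolding normal_subgroup_carrier_iff[OF generate_is_subgroup[OF T]] by auto

lemma relative_closure_incl: "S \<subseteq> relative_closure G T S"
  unfolding relative_closure_def normal_closure_def hull_def
  by (auto intro: generate.incl)

text \<open>The minimality of the normal closure, applied to \<open>H \<inter> generate G T\<close>. The form with an arbitrary subgroup \<open>H\<close> suits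
  groups that are normal in all of \<open>G\<close>, such as \<open>Trans(N, IN)\<close>.\<close>

lemma relative_closure_least:
  assumes "subgroup H G" and "S \<subseteq> H"
    and "\<And>g h. g \<in> generate G T \<Longrightarrow> h \<in> H \<Longrightarrow> g \<otimes> h \<otimes> inv g \<in> H"
  shows "relative_closure G T S \<subseteq> H"
proof -
  let ?K = "generate G T"
  have sub: "subgroup ?K G"
    by (rule generate_is_subgroup[OF T])
  have HK: "subgroup (H \<inter> ?K) G"
    using assms(1) sub by (rule subgroups_Inter_pair)
  have "H \<inter> ?K \<lhd> G\<lparr>carrier := ?K\<rparr>"
    unfolding normal_subgroup_carrier_iff[OF sub]
    using HK assms(3)
    by (blast intro: subgroup.m_closed[OF sub] subgroup.m_inv_closed[OF sub])
  moreover have "generate (G\<lparr>carrier := ?K\<rparr>) S \<subseteq> H \<inter> ?K"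
    unfolding generate_consistent[OF S sub]
    using generate_subgroup_incl[OF _ HK] assms(2) S by blast
  ultimately show ?thesis
    using hull_minimal[of "generate (G\<lparr>carrier := ?K\<rparr>) S" "H \<inter> ?K" "\<lambda>L. L \<lhd> G\<lparr>carrier := ?K\<rparr>"]
    unfolding relative_closure_def normal_closure_def by simp
qed

end

text \<open>Two descriptions of a relative group agree once each generating set lies in the group defined by the other one.\<close>

lemma relative_closure_eqI:
  assumes "T \<subseteq> carrier G" "S \<subseteq> generate G T" "T' \<subseteq> carrier G" "S' \<subseteq> generate G T'"
    and "T \<subseteq> generate G T'" "T' \<subseteq> generate G T"
    and "S \<subseteq> relative_closure G T' S'" "S' \<subseteq> relative_closure G T S"
  shows "relative_closure G T S = relative_closure G T' S'"
proof -
  have eq: "generate G T = generate G T'"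
    using assms by (intro equalityI generate_subgroup_incl generate_is_subgroup)
  show ?thesis
  proof
    show "relative_closure G T S \<subseteq> relative_closure G T' S'"
      using assms(1,2,7) relative_closure_conj[OF assms(3,4)] relative_closure_subgroup[OF assms(3,4)]
      by (intro relative_closure_least) (simp_all add: eq)
    show "relative_closure G T' S' \<subseteq> relative_closure G T S"
      using assms(3,4,8) relative_closure_conj[OF assms(1,2)] relative_closure_subgroup[OF assms(1,2)]
      by (intro relative_closure_least) (simp_all add: eq)
  qed
qed

end

text \<open>Both inclusions come from minimality: the preimage of a normal subgroup is normal, and so is the image, as the
  conjugating elements range over the image of \<open>generate G T\<close>.\<close>

lemma iso_image_relative_closure:
  assumes iso: "\<psi> \<in> iso G H" and G: "group G" and H: "group H"
    and T: "T \<subseteq> carrier G" and S: "S \<subseteq> generate G T"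
  shows "\<psi> ` relative_closure G T S = relative_closure H (\<psi> ` T) (\<psi> ` S)"
proof -
  interpret G: group G by (rule G)
  interpret H: group H by (rule H)
  interpret group_hom G H \<psi>
    using iso by unfold_locales (auto simp: iso_def)
  have gen: "generate H (\<psi> ` T) = \<psi> ` generate G T"
    by (rule generate_img[OF T])
  have T': "\<psi> ` T \<subseteq> carrier H"
    using T by auto
  have S': "\<psi> ` S \<subseteq> generate H (\<psi> ` T)"
    using S gen by auto
  have carr: "generate G T \<subseteq> carrier G"
    by (rule G.generate_incl[OF T])
  note rel = G.relative_closure_subgroup[OF T S] G.relative_closure_subset[OF T S]
    G.relative_closure_conj[OF T S] G.relative_closure_incl[OF T S]
  note rel' = H.relative_closure_subgroup[OF T' S'] H.relative_closure_subset[OF T' S']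
    H.relative_closure_conj[OF T' S'] H.relative_closure_incl[OF T' S']
  show ?thesis
  proof
    let ?V = "{g \<in> carrier G. \<psi> g \<in> relative_closure H (\<psi> ` T) (\<psi> ` S)}"
    have "relative_closure G T S \<subseteq> ?V"
    proof (rule G.relative_closure_least[OF T S])
      show "subgroup ?V G"
        by (intro G.subgroupI) (auto simp: subgroup.m_closed[OF rel'(1)]
          subgroup.m_inv_closed[OF rel'(1)] subgroup.one_closed[OF rel'(1)]
          intro!: exI[of _ "\<one>\<^bsub>G\<^esub>"])
      show "S \<subseteq> ?V"
        using rel'(4) S carr by auto
      show "g \<otimes>\<^bsub>G\<^esub> h \<otimes>\<^bsub>G\<^esub> inv\<^bsub>G\<^esub> g \<in> ?V" if "g \<in> generate G T" "h \<in> ?V" for g h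
        using that carr rel'(3)[of "\<psi> g" "\<psi> h"] gen by auto
    qed
    then show "\<psi> ` relative_closure G T S \<subseteq> relative_closure H (\<psi> ` T) (\<psi> ` S)"
      by auto
  next
    show "relative_closure H (\<psi> ` T) (\<psi> ` S) \<subseteq> \<psi> ` relative_closure G T S"
    proof (rule H.relative_closure_least[OF T' S'])
      show "subgroup (\<psi> ` relative_closure G T S) H"
        using rel(1) by (rule subgroup_img_is_subgroup)
      show "\<psi> ` S \<subseteq> \<psi> ` relative_closure G T S"
        using rel(4) by auto
      fix g h assume "g \<in> generate H (\<psi> ` T)" "h \<in> \<psi> ` relative_closure G T S"
      then obtain g' h' where gh: "g' \<in> generate G T" "g = \<psi> g'" "h' \<in> relative_closure G T S" "h = \<psi> h'"
        using gen by auto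
      then have "g \<otimes>\<^bsub>H\<^esub> h \<otimes>\<^bsub>H\<^esub> inv\<^bsub>H\<^esub> g = \<psi> (g' \<otimes>\<^bsub>G\<^esub> h' \<otimes>\<^bsub>G\<^esub> inv\<^bsub>G\<^esub> g')"
        using carr rel(2) by (simp add: subset_iff)
      then show "g \<otimes>\<^bsub>H\<^esub> h \<otimes>\<^bsub>H\<^esub> inv\<^bsub>H\<^esub> g \<in> \<psi> ` relative_closure G T S"
        using gh rel(3) by auto
    qed
  qed
qed

section \<open>Rank-one endomorphisms given by a pairing with dual bases\<close>

text \<open>Two free modules in perfect duality. The case of interest is a free module \<open>N\<close> paired with its dual, but in
  that form vectors and functionals are different kinds of objects. With two arbitrary modules the situation is
  symmetric (\<open>swap\<close>), and every statement about one side gives the mirrored one without a second proof.\<close>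

locale dual_bases =
  R: cring R + V: Module.module R V + W: Module.module R W
  for R :: "('a, 'r) ring_scheme" (structure)
    and V :: "('a, 'b, 'm) module_scheme" and W :: "('a, 'c, 'n) module_scheme" +
  fixes pair :: "'b \<Rightarrow> 'c \<Rightarrow> 'a" and A :: "'i set" and x :: "'i \<Rightarrow> 'b" and y :: "'i \<Rightarrow> 'c"
  assumes pair_closed: "v \<in> carrier V \<Longrightarrow> w \<in> carrier W \<Longrightarrow> pair v w \<in> carrier R"
    and pair_add_left: "v \<in> carrier V \<Longrightarrow> v' \<in> carrier V \<Longrightarrow> w \<in> carrier W \<Longrightarrow>
      pair (v \<oplus>\<^bsub>V\<^esub> v') w = pair v w \<oplus> pair v' w"
    and pair_add_right: "v \<in> carrier V \<Longrightarrow> w \<in> carrier W \<Longrightarrow> w' \<in> carrier W \<Longrightarrow>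
      pair v (w \<oplus>\<^bsub>W\<^esub> w') = pair v w \<oplus> pair v w'"
    and pair_smult_left: "a \<in> carrier R \<Longrightarrow> v \<in> carrier V \<Longrightarrow> w \<in> carrier W \<Longrightarrow>
      pair (a \<odot>\<^bsub>V\<^esub> v) w = a \<otimes> pair v w"
    and pair_smult_right: "a \<in> carrier R \<Longrightarrow> v \<in> carrier V \<Longrightarrow> w \<in> carrier W \<Longrightarrow>
      pair v (a \<odot>\<^bsub>W\<^esub> w) = a \<otimes> pair v w"
    and finite_index: "finite A"
    and x_closed: "i \<in> A \<Longrightarrow> x i \<in> carrier V"
    and y_closed: "i \<in> A \<Longrightarrow> y i \<in> carrier W"
    and pair_basis: "i \<in> A \<Longrightarrow> j \<in> A \<Longrightarrow> pair (x i) (y j) = (if i = j then \<one> else \<zero>)"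
    and expand_left: "v \<in> carrier V \<Longrightarrow> v = (\<Oplus>\<^bsub>V\<^esub> i\<in>A. pair v (y i) \<odot>\<^bsub>V\<^esub> x i)"
    and expand_right: "w \<in> carrier W \<Longrightarrow> w = (\<Oplus>\<^bsub>W\<^esub> i\<in>A. pair (x i) w \<odot>\<^bsub>W\<^esub> y i)"
begin

lemmas pair_simps = pair_closed pair_add_left pair_add_right pair_smult_left pair_smult_right
  x_closed y_closed pair_basis

lemma swap: "dual_bases R W V (\<lambda>w v. pair v w) A y x"
  by unfold_locales (auto simp: pair_simps finite_index intro: expand_left expand_right)

lemma pair_zero_right: "v \<in> carrier V \<Longrightarrow> pair v \<zero>\<^bsub>W\<^esub> = \<zero>"
  using pair_smult_right[of \<zero> v "\<zero>\<^bsub>W\<^esub>"] by (simp add: pair_closed)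

lemma pair_finsum_right:
  assumes "v \<in> carrier V" "finite B" "f \<in> B \<rightarrow> carrier W"
  shows "pair v (\<Oplus>\<^bsub>W\<^esub> i\<in>B. f i) = (\<Oplus> i\<in>B. pair v (f i))"
  using assms(2,3)
proof (induction B)
  case empty
  then show ?case
    using assms(1) by (simp add: pair_zero_right)
next
  case (insert i B)
  then show ?case
    using assms(1) by (simp add: Pi_def pair_simps)
qed

text \<open>In coordinates the pairing is the standard scalar product.\<close>

lemma pair_expand:
  assumes "v \<in> carrier V" "w \<in> carrier W"
  shows "pair v w = (\<Oplus> i\<in>A. pair v (y i) \<otimes> pair (x i) w)"
proof -
  have "pair v w = pair v (\<Oplus>\<^bsub>W\<^esub> i\<in>A. pair (x i) w \<odot>\<^bsub>W\<^esub> y i)"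
    using expand_right[OF assms(2)] by simp
  also have "\<dots> = (\<Oplus> i\<in>A. pair v (pair (x i) w \<odot>\<^bsub>W\<^esub> y i))"
    using assms by (intro pair_finsum_right) (auto simp: finite_index pair_simps)
  also have "\<dots> = (\<Oplus> i\<in>A. pair v (y i) \<otimes> pair (x i) w)"
    using assms by (intro R.finsum_cong') (auto simp: pair_simps R.m_comm)
  finally show ?thesis .
qed

end

lemma (in Module.module) finsum_smult_rdistr:
  assumes "finite B" "f \<in> B \<rightarrow> carrier R" "v \<in> carrier M"
  shows "(\<Oplus>\<^bsub>R\<^esub> i\<in>B. f i) \<odot>\<^bsub>M\<^esub> v = (\<Oplus>\<^bsub>M\<^esub> i\<in>B. f i \<odot>\<^bsub>M\<^esub> v)"
  using assms by (induction B) (auto simp: Pi_def smult_l_distr)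

text \<open>Here \<open>P v w\<close> stands for: the map \<open>1 + v \<otimes> w\<close> belongs to a given group \<open>H\<close> that contains the elementary
  transvections with coefficients in \<open>I\<close>. The two additivity axioms are closure of \<open>H\<close> under products, since
  \<open>(1 + v \<otimes> w) (1 + v' \<otimes> w) = 1 + (v + v') \<otimes> w\<close> if \<open>v\<close> and \<open>v'\<close> are orthogonal to \<open>w\<close>, and \<open>scale\<close> moves a
  scalar across the tensor sign. As a predicate on pairs, membership keeps the symmetry of \<open>dual_bases\<close>, which is
  lost when pairs become endomorphisms of one of the modules.\<close>

locale rank_one_family = dual_bases R V W pair A x y
  for R :: "('a, 'r) ring_scheme" (structure)
    and V :: "('a, 'b, 'm) module_scheme" and W :: "('a, 'c, 'n) module_scheme"
    and pair A x y +
  fixes P :: "'b \<Rightarrow> 'c \<Rightarrow> bool" and I :: "'a set"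
  assumes ideal: "ideal I R"
    and zero_left: "w \<in> carrier W \<Longrightarrow> P \<zero>\<^bsub>V\<^esub> w"
    and zero_right: "v \<in> carrier V \<Longrightarrow> P v \<zero>\<^bsub>W\<^esub>"
    and add_left: "v \<in> carrier V \<Longrightarrow> v' \<in> carrier V \<Longrightarrow> w \<in> carrier W \<Longrightarrow>
      pair v w = \<zero> \<Longrightarrow> pair v' w = \<zero> \<Longrightarrow> P v w \<Longrightarrow> P v' w \<Longrightarrow> P (v \<oplus>\<^bsub>V\<^esub> v') w"
    and add_right: "v \<in> carrier V \<Longrightarrow> w \<in> carrier W \<Longrightarrow> w' \<in> carrier W \<Longrightarrow>
      pair v w = \<zero> \<Longrightarrow> pair v w' = \<zero> \<Longrightarrow> P v w \<Longrightarrow> P v w' \<Longrightarrow> P v (w \<oplus>\<^bsub>W\<^esub> w')"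
    and scale: "a \<in> carrier R \<Longrightarrow> v \<in> carrier V \<Longrightarrow> w \<in> carrier W \<Longrightarrow>
      P (a \<odot>\<^bsub>V\<^esub> v) w \<longleftrightarrow> P v (a \<odot>\<^bsub>W\<^esub> w)"
    and elem: "i \<in> A \<Longrightarrow> j \<in> A \<Longrightarrow> i \<noteq> j \<Longrightarrow> a \<in> I \<Longrightarrow> P (a \<odot>\<^bsub>V\<^esub> x i) (y j)"
begin

lemma I_carrier: "a \<in> I \<Longrightarrow> a \<in> carrier R"
  using ideal by (meson additive_subgroup.a_Hcarr ideal.axioms(1))

lemma family_swap: "rank_one_family R W V (\<lambda>w v. pair v w) A y x (\<lambda>w v. P v w) I"
proof (intro rank_one_family.intro rank_one_family_axioms.intro)
  show "P (x j) (a \<odot>\<^bsub>W\<^esub> y i)" if "i \<in> A" "j \<in> A" "i \<noteq> j" "a \<in> I" for i j a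
    using that elem[of j i a] by (simp add: scale I_carrier x_closed y_closed)
qed (fact swap ideal zero_left zero_right | rule add_left add_right scale[symmetric]; assumption)+

lemma sum_right:
  assumes "v \<in> carrier V" "finite B" "f \<in> B \<rightarrow> carrier W"
    and "\<And>i. i \<in> B \<Longrightarrow> pair v (f i) = \<zero>" "\<And>i. i \<in> B \<Longrightarrow> P v (f i)"
  shows "P v (\<Oplus>\<^bsub>W\<^esub> i\<in>B. f i)"
  using assms(2-5)
proof (induction B)
  case empty
  then show ?case
    using assms(1) by (simp add: zero_right)
next
  case (insert i B)
  have "(\<Oplus> j\<in>B. pair v (f j)) = \<zero>"
    using insert by (intro R.add.finprod_one_eqI) auto
  then show ?case
    using insert assms(1) by (simp add: Pi_def add_right pair_finsum_right)
qed

lemma sum_left: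
  assumes "w \<in> carrier W" "finite B" "f \<in> B \<rightarrow> carrier V"
    and "\<And>i. i \<in> B \<Longrightarrow> pair (f i) w = \<zero>" "\<And>i. i \<in> B \<Longrightarrow> P (f i) w"
  shows "P (\<Oplus>\<^bsub>V\<^esub> i\<in>B. f i) w"
  using rank_one_family.sum_right[OF family_swap] assms by blast

lemma elem_smult:
  assumes "i \<in> A" "j \<in> A" "i \<noteq> j" "a \<in> I" "c \<in> carrier R"
  shows "P (a \<odot>\<^bsub>V\<^esub> x i) (c \<odot>\<^bsub>W\<^esub> y j)"
proof -
  have "P ((c \<otimes> a) \<odot>\<^bsub>V\<^esub> x i) (y j)"
    using assms ideal by (intro elem) (auto intro: ideal.I_l_closed)
  then show ?thesis
    using assms scale[of c "a \<odot>\<^bsub>V\<^esub> x i" "y j"]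
    by (simp add: I_carrier x_closed y_closed V.smult_assoc1)
qed

end

text \<open>\<open>Q\<close> is membership in a group \<open>G\<close> that normalises \<open>H\<close> and contains all elementary transvections. The axiom
  expresses that \<open>1 + \<langle>s, e\<rangle> (t \<otimes> u)\<close> is the commutator of \<open>1 + s \<otimes> u\<close> and \<open>1 + t \<otimes> e\<close>, which lies in \<open>H\<close> as soon as
  one of the two factors does. Both alternatives are needed: they are interchanged by the symmetry.\<close>

locale transvection_system =
  P: rank_one_family R V W pair A x y P I + Q: rank_one_family R V W pair A x y Q "carrier R"
  for R :: "('a, 'r) ring_scheme" (structure)
    and V :: "('a, 'b, 'm) module_scheme" and W :: "('a, 'c, 'n) module_scheme"
    and pair A x y P Q I +
  assumes commutator:
      "s \<in> carrier V \<Longrightarrow> t \<in> carrier V \<Longrightarrow> u \<in> carrier W \<Longrightarrow> e \<in> carrier W \<Longrightarrow>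
       pair t u = \<zero> \<Longrightarrow> pair t e = \<zero> \<Longrightarrow> pair s u = \<zero> \<Longrightarrow>
       P s u \<and> Q t e \<or> Q s u \<and> P t e \<Longrightarrow> P (pair s e \<odot>\<^bsub>V\<^esub> t) u"
begin

lemma system_swap:
  "transvection_system R W V (\<lambda>w v. pair v w) A y x (\<lambda>w v. P v w) (\<lambda>w v. Q v w) I"
proof -
  interpret SP: rank_one_family R W V "\<lambda>w v. pair v w" A y x "\<lambda>w v. P v w" I
    by (rule P.family_swap)
  interpret SQ: rank_one_family R W V "\<lambda>w v. pair v w" A y x "\<lambda>w v. Q v w" "carrier R"
    by (rule Q.family_swap)
  show ?thesis
  proof unfold_locales
    fix s t u e
    assume *: "s \<in> carrier W" "t \<in> carrier W" "u \<in> carrier V" "e \<in> carrier V"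
      "pair u t = \<zero>" "pair e t = \<zero>" "pair u s = \<zero>"
      "P u s \<and> Q e t \<or> Q u s \<and> P e t"
    then have "P (pair e s \<odot>\<^bsub>V\<^esub> u) t"
      by (intro commutator) auto
    then show "P u (pair e s \<odot>\<^bsub>W\<^esub> t)"
      using * by (simp add: P.scale P.pair_closed)
  qed
qed

text \<open>The vector \<open>t\<close> is the Koszul relation between the coordinates \<open>i\<close> and \<open>j\<close> of \<open>q\<close>, hence orthogonal to \<open>q\<close>. It is
  orthogonal to the part \<open>u\<close> of \<open>q\<close> supported on \<open>{i, j}\<close> and to every other basis vector, so additivity allows one
  to treat \<open>u\<close> and the remaining components of \<open>q\<close> separately.\<close>

lemma koszul_relation_mem:
  assumes A: "card A \<ge> 3" and ij: "i \<in> A" "j \<in> A" "i \<noteq> j" and a: "a \<in> I" and q: "q \<in> carrier W"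
  defines "t \<equiv> pair (x j) q \<odot>\<^bsub>V\<^esub> x i \<oplus>\<^bsub>V\<^esub> (\<ominus> pair (x i) q) \<odot>\<^bsub>V\<^esub> x j"
  shows "P (a \<odot>\<^bsub>V\<^esub> t) q"
proof -
  note simps = P.pair_simps P.I_carrier[OF a] q ij
  let ?c = "\<lambda>i. pair (x i) q"
  have c: "?c l \<in> carrier R" if "l \<in> A" for l
    using that by (simp add: simps)
  have t: "t \<in> carrier V"
    by (simp add: t_def simps)
  define u where "u = ?c i \<odot>\<^bsub>W\<^esub> y i \<oplus>\<^bsub>W\<^esub> ?c j \<odot>\<^bsub>W\<^esub> y j"
  have u: "u \<in> carrier W"
    by (simp add: u_def simps)
  have tu: "pair t u = \<zero>"
    using ij not_sym[OF ij(3)] by (simp add: t_def u_def simps P.R.m_comm P.R.l_minus P.R.r_minus P.R.r_neg)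
  have split: "q = u \<oplus>\<^bsub>W\<^esub> (\<Oplus>\<^bsub>W\<^esub> l\<in>A - {i, j}. ?c l \<odot>\<^bsub>W\<^esub> y l)"
  proof -
    have "A = insert i (insert j (A - {i, j}))"
      using ij by auto
    then have "q = (\<Oplus>\<^bsub>W\<^esub> l\<in>insert i (insert j (A - {i, j})). ?c l \<odot>\<^bsub>W\<^esub> y l)"
      using P.expand_right[OF q] by simp
    also have "\<dots> = u \<oplus>\<^bsub>W\<^esub> (\<Oplus>\<^bsub>W\<^esub> l\<in>A - {i, j}. ?c l \<odot>\<^bsub>W\<^esub> y l)"
      using ij P.finite_index unfolding u_def
      by (subst P.W.finsum_insert; simp add: Pi_def simps P.W.M.a_assoc)+
    finally show ?thesis .
  qed
  have t_at: "pair t (y l) = \<zero>" if "l \<in> A - {i, j}" for l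
    using that ij by (auto simp: t_def simps)
  have at: "a \<odot>\<^bsub>V\<^esub> t = (a \<otimes> ?c j) \<odot>\<^bsub>V\<^esub> x i \<oplus>\<^bsub>V\<^esub> (a \<otimes> (\<ominus> ?c i)) \<odot>\<^bsub>V\<^esub> x j"
    by (simp add: t_def simps P.V.smult_r_distr P.V.smult_assoc1)
  have aI: "a \<otimes> c \<in> I" if "c \<in> carrier R" for c
    using that a P.ideal by (simp add: ideal.I_r_closed)
  have near: "P (a \<odot>\<^bsub>V\<^esub> t) u"
  proof -
    have "card (A - {i, j}) > 0"
      using A ij P.finite_index by (simp add: card_Diff_subset)
    then obtain l where l: "l \<in> A" "l \<noteq> i" "l \<noteq> j"
      by (metis Diff_iff card_gt_0_iff ex_in_conv insertCI)
    \<comment> \<open>The coefficient \<open>a \<in> I\<close> goes to this factor of the commutator; the other one has arbitrary coefficients.\<close>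
    have "P (a \<odot>\<^bsub>V\<^esub> x l) u"
      unfolding u_def using l a
      by (intro P.add_right P.elem_smult) (auto simp: simps)
    moreover have "Q t (y l)"
      unfolding t_def using l
      by (intro Q.add_left Q.elem) (auto simp: simps)
    ultimately have "P (pair (a \<odot>\<^bsub>V\<^esub> x l) (y l) \<odot>\<^bsub>V\<^esub> t) u"
      using l t u tu t_at[of l] by (intro commutator) (auto simp: simps u_def)
    then show ?thesis
      using l by (simp add: simps)
  qed
  have far: "P (a \<odot>\<^bsub>V\<^esub> t) (\<Oplus>\<^bsub>W\<^esub> l\<in>A - {i, j}. ?c l \<odot>\<^bsub>W\<^esub> y l)"
  proof (rule P.sum_right)
    fix l assume l: "l \<in> A - {i, j}"
    show "pair (a \<odot>\<^bsub>V\<^esub> t) (?c l \<odot>\<^bsub>W\<^esub> y l) = \<zero>"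
      using l t t_at by (simp add: simps)
    show "P (a \<odot>\<^bsub>V\<^esub> t) (?c l \<odot>\<^bsub>W\<^esub> y l)"
      unfolding at using l
      by (intro P.add_left P.elem_smult aI) (auto simp: simps)
  qed (use t P.finite_index in \<open>auto simp: simps\<close>)
  have "pair (a \<odot>\<^bsub>V\<^esub> t) (\<Oplus>\<^bsub>W\<^esub> l\<in>A - {i, j}. ?c l \<odot>\<^bsub>W\<^esub> y l) = \<zero>"
  proof (subst P.pair_finsum_right)
    show "(\<Oplus>l\<in>A - {i, j}. pair (a \<odot>\<^bsub>V\<^esub> t) (?c l \<odot>\<^bsub>W\<^esub> y l)) = \<zero>"
      using t t_at by (intro P.R.add.finprod_one_eqI) (simp add: simps)
  qed (use t P.finite_index in \<open>auto simp: simps\<close>)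
  then have "P (a \<odot>\<^bsub>V\<^esub> t) (u \<oplus>\<^bsub>W\<^esub> (\<Oplus>\<^bsub>W\<^esub> l\<in>A - {i, j}. ?c l \<odot>\<^bsub>W\<^esub> y l))"
    using near far t u tu
    by (intro P.add_right) (auto simp: simps intro!: P.W.M.finsum_closed)
  then show ?thesis
    by (simp flip: split)
qed

text \<open>A vector orthogonal to a unimodular one is a combination of Koszul relations. This is done in two steps: \<open>s i\<close> is
  the projection of the basis vector \<open>x i\<close> to the orthogonal complement of \<open>q\<close> along \<open>f\<close>; the projections
  \<open>s i\<close> express \<open>v\<close> with the coefficients of \<open>v\<close> itself, and each of them is a combination of Koszul
  relations with the coefficients of \<open>f\<close>. All terms stay orthogonal to \<open>q\<close>, as additivity requires.\<close>

theorem unimodular_right: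
  assumes A: "card A \<ge> 3" and v: "v \<in> carrier V" and q: "q \<in> carrier W" and vq: "pair v q = \<zero>"
    and f: "f \<in> carrier V" and fq: "pair f q = \<one>"
    and vI: "\<And>i. i \<in> A \<Longrightarrow> pair v (y i) \<in> I"
  shows "P v q"
proof -
  note simps = P.pair_simps v q f vI
  let ?c = "\<lambda>i. pair (x i) q"
  define t where "t i j = ?c j \<odot>\<^bsub>V\<^esub> x i \<oplus>\<^bsub>V\<^esub> (\<ominus> ?c i) \<odot>\<^bsub>V\<^esub> x j" for i j
  define s where "s i = x i \<oplus>\<^bsub>V\<^esub> (\<ominus> ?c i) \<odot>\<^bsub>V\<^esub> f" for i
  have t: "t i j \<in> carrier V" if "i \<in> A" "j \<in> A" for i j
    using that by (simp add: t_def simps)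
  have s: "s i \<in> carrier V" if "i \<in> A" for i
    using that by (simp add: s_def simps)
  have tq: "pair (t i j) q = \<zero>" if "i \<in> A" "j \<in> A" for i j
    using that by (simp add: t_def simps P.R.m_comm P.R.l_minus P.R.r_minus P.R.r_neg)
  have sq: "pair (s i) q = \<zero>" if "i \<in> A" for i
    using that fq by (simp add: s_def simps P.R.r_neg)
  \<comment> \<open>The coefficients of \<open>x i\<close> add up to \<open>\<langle>f, q\<rangle> = \<one>\<close>.\<close>
  have s_eq: "s i = (\<Oplus>\<^bsub>V\<^esub> j\<in>A. pair f (y j) \<odot>\<^bsub>V\<^esub> t i j)" if i: "i \<in> A" for i
  proof -
    have "(\<Oplus>\<^bsub>V\<^esub> j\<in>A. pair f (y j) \<odot>\<^bsub>V\<^esub> t i j) =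
        (\<Oplus>\<^bsub>V\<^esub> j\<in>A. (pair f (y j) \<otimes> ?c j) \<odot>\<^bsub>V\<^esub> x i \<oplus>\<^bsub>V\<^esub> (\<ominus> ?c i) \<odot>\<^bsub>V\<^esub> (pair f (y j) \<odot>\<^bsub>V\<^esub> x j))"
      using i by (intro P.V.M.finsum_cong')
        (auto simp: t_def simps P.V.smult_r_distr P.R.m_comm simp flip: P.V.smult_assoc1)
    also have "\<dots> = (\<Oplus>\<^bsub>V\<^esub> j\<in>A. (pair f (y j) \<otimes> ?c j) \<odot>\<^bsub>V\<^esub> x i) \<oplus>\<^bsub>V\<^esub>
        (\<Oplus>\<^bsub>V\<^esub> j\<in>A. (\<ominus> ?c i) \<odot>\<^bsub>V\<^esub> (pair f (y j) \<odot>\<^bsub>V\<^esub> x j))"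
      using i by (intro P.V.M.finsum_addf) (auto simp: simps)
    also have "(\<Oplus>\<^bsub>V\<^esub> j\<in>A. (pair f (y j) \<otimes> ?c j) \<odot>\<^bsub>V\<^esub> x i) = \<one> \<odot>\<^bsub>V\<^esub> x i"
      using i fq P.pair_expand[OF f q] P.finite_index
      by (subst P.V.finsum_smult_rdistr[symmetric]) (auto simp: simps)
    also have "(\<Oplus>\<^bsub>V\<^esub> j\<in>A. (\<ominus> ?c i) \<odot>\<^bsub>V\<^esub> (pair f (y j) \<odot>\<^bsub>V\<^esub> x j)) = (\<ominus> ?c i) \<odot>\<^bsub>V\<^esub> f"
      using i P.expand_left[OF f] P.finite_index
      by (subst P.V.finsum_smult_ldistr[symmetric]) (auto simp: simps)
    finally show ?thesis
      using i by (simp add: s_def simps)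
  qed
  have P_s: "P (a \<odot>\<^bsub>V\<^esub> s i) q" if i: "i \<in> A" and a: "a \<in> I" for i a
  proof -
    have aR: "a \<in> carrier R"
      by (rule P.I_carrier[OF a])
    have eq: "a \<odot>\<^bsub>V\<^esub> s i = (\<Oplus>\<^bsub>V\<^esub> j\<in>A. (a \<otimes> pair f (y j)) \<odot>\<^bsub>V\<^esub> t i j)"
    proof -
      have "a \<odot>\<^bsub>V\<^esub> s i = (\<Oplus>\<^bsub>V\<^esub> j\<in>A. a \<odot>\<^bsub>V\<^esub> (pair f (y j) \<odot>\<^bsub>V\<^esub> t i j))"
        unfolding s_eq[OF i] using aR i t P.finite_index
        by (intro P.V.finsum_smult_ldistr) (auto simp: simps)
      also have "\<dots> = (\<Oplus>\<^bsub>V\<^esub> j\<in>A. (a \<otimes> pair f (y j)) \<odot>\<^bsub>V\<^esub> t i j)"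
        using aR i t by (intro P.V.M.finsum_cong') (auto simp: simps P.V.smult_assoc1)
      finally show ?thesis .
    qed
    show ?thesis
      unfolding eq
    proof (rule P.sum_left)
      fix j assume j: "j \<in> A"
      show "pair ((a \<otimes> pair f (y j)) \<odot>\<^bsub>V\<^esub> t i j) q = \<zero>"
        using i j t tq aR by (simp add: simps)
      show "P ((a \<otimes> pair f (y j)) \<odot>\<^bsub>V\<^esub> t i j) q"
      \<comment> \<open>The sum includes \<open>j = i\<close>, where the Koszul relation is \<open>0\<close>.\<close>
      proof (cases "i = j")
        case True
        then have "t i j = \<zero>\<^bsub>V\<^esub>"
          using i by (simp add: t_def simps P.V.smult_l_minus P.V.M.r_neg)
        then show ?thesis
          using aR j q by (simp add: simps P.zero_left)
      next
        case False
        have "a \<otimes> pair f (y j) \<in> I"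
          using a j P.ideal by (simp add: ideal.I_r_closed simps)
        then show ?thesis
          unfolding t_def using A i j q False by (intro koszul_relation_mem)
      qed
    qed (use P.finite_index q aR i t in \<open>auto simp: simps\<close>)
  qed
  have vR: "pair v (y i) \<in> carrier R" if "i \<in> A" for i
    using that by (simp add: simps)
  \<comment> \<open>The terms with \<open>f\<close> add up to \<open>\<langle>v, q\<rangle> f\<close>, which is \<open>0\<close>.\<close>
  have v_eq: "v = (\<Oplus>\<^bsub>V\<^esub> i\<in>A. pair v (y i) \<odot>\<^bsub>V\<^esub> s i)"
  proof -
    have "(\<Oplus>\<^bsub>V\<^esub> i\<in>A. pair v (y i) \<odot>\<^bsub>V\<^esub> s i) =
        (\<Oplus>\<^bsub>V\<^esub> i\<in>A. pair v (y i) \<odot>\<^bsub>V\<^esub> x i \<oplus>\<^bsub>V\<^esub> (pair v (y i) \<otimes> ?c i) \<odot>\<^bsub>V\<^esub> (\<ominus> \<one> \<odot>\<^bsub>V\<^esub> f))"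
      using vR by (intro P.V.M.finsum_cong')
        (auto simp: s_def simps P.V.smult_r_distr P.R.r_minus simp flip: P.V.smult_assoc1)
    also have "\<dots> = (\<Oplus>\<^bsub>V\<^esub> i\<in>A. pair v (y i) \<odot>\<^bsub>V\<^esub> x i) \<oplus>\<^bsub>V\<^esub>
        (\<Oplus>\<^bsub>V\<^esub> i\<in>A. (pair v (y i) \<otimes> ?c i) \<odot>\<^bsub>V\<^esub> (\<ominus> \<one> \<odot>\<^bsub>V\<^esub> f))"
      using vR by (intro P.V.M.finsum_addf) (auto simp: simps)
    also have "(\<Oplus>\<^bsub>V\<^esub> i\<in>A. (pair v (y i) \<otimes> ?c i) \<odot>\<^bsub>V\<^esub> (\<ominus> \<one> \<odot>\<^bsub>V\<^esub> f)) = \<zero> \<odot>\<^bsub>V\<^esub> (\<ominus> \<one> \<odot>\<^bsub>V\<^esub> f)"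
      using vq vR P.pair_expand[OF v q] P.finite_index
      by (subst P.V.finsum_smult_rdistr[symmetric]) (auto simp: simps)
    also have "(\<Oplus>\<^bsub>V\<^esub> i\<in>A. pair v (y i) \<odot>\<^bsub>V\<^esub> x i) = v"
      using P.expand_left[OF v] by simp
    finally show ?thesis
      using v f by simp
  qed
  have "P (\<Oplus>\<^bsub>V\<^esub> i\<in>A. pair v (y i) \<odot>\<^bsub>V\<^esub> s i) q"
    using P_s vI vR s sq q P.finite_index by (intro P.sum_left) (auto simp: simps)
  then show ?thesis
    by (simp flip: v_eq)
qed

theorem unimodular_left:
  assumes "card A \<ge> 3" and "v \<in> carrier V" and "q \<in> carrier W" and "pair v q = \<zero>"
    and "w \<in> carrier W" and "pair v w = \<one>"
    and "\<And>i. i \<in> A \<Longrightarrow> pair (x i) q \<in> I"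
  shows "P v q"
  using transvection_system.unimodular_right[OF system_swap] assms by blast

end

section \<open>Submodules generated by an ideal\<close>

context dual_bases
begin

text \<open>Membership in \<open>IW\<close> is recognised by pairing with all of \<open>V\<close>. In this form it is evidently preserved by
  automorphisms.\<close>

lemma ideal_smult_closed:
  assumes I: "ideal I R" and q: "q \<in> ideal_smult I W"
  shows "q \<in> carrier W" and "v \<in> carrier V \<Longrightarrow> pair v q \<in> I"
proof -
  interpret I: ideal I R by (rule I)
  have "q \<in> carrier W \<and> (\<forall>v\<in>carrier V. pair v q \<in> I)"
    using q unfolding ideal_smult_def
  proof (induction q rule: generate.induct)
    case one
    then show ?case
      using pair_zero_right by simp
  next
    case (incl h)
    then show ?case
      by (auto simp: pair_smult_right I.a_Hcarr pair_closed I.I_r_closed)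
  next
    case (inv h)
    then obtain a w where h: "h = a \<odot>\<^bsub>W\<^esub> w" "a \<in> I" "w \<in> carrier W"
      by auto
    have "inv\<^bsub>add_monoid W\<^esub> h = (\<ominus> a) \<odot>\<^bsub>W\<^esub> w"
      using h W.smult_l_minus[of a w] by (simp add: I.a_Hcarr a_inv_def[of W])
    moreover have "\<ominus> a \<in> I"
      using h by simp
    ultimately show ?case
      using h(3) by (simp add: pair_smult_right I.a_Hcarr pair_closed I.I_r_closed)
  next
    case (eng h1 h2)
    then show ?case
      by (simp add: pair_add_right)
  qed
  then show "q \<in> carrier W" and "v \<in> carrier V \<Longrightarrow> pair v q \<in> I"
    by auto
qed

lemma ideal_smultI:
  assumes q: "q \<in> carrier W" "\<And>i. i \<in> A \<Longrightarrow> pair (x i) q \<in> I"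
  shows "q \<in> ideal_smult I W"
proof -
  let ?G = "{a \<odot>\<^bsub>W\<^esub> w | a w. a \<in> I \<and> w \<in> carrier W}"
  have "(\<Oplus>\<^bsub>W\<^esub> i\<in>B. pair (x i) q \<odot>\<^bsub>W\<^esub> y i) \<in> generate (add_monoid W) ?G"
    if "finite B" "B \<subseteq> A" for B
    using that
  proof (induction B)
    case empty
    then show ?case
      using generate.one[of "add_monoid W"] by simp
  next
    case (insert i B)
    then have "pair (x i) q \<odot>\<^bsub>W\<^esub> y i \<in> generate (add_monoid W) ?G"
      using q y_closed by (intro generate.incl) blast
    then have "pair (x i) q \<odot>\<^bsub>W\<^esub> y i \<oplus>\<^bsub>W\<^esub> (\<Oplus>\<^bsub>W\<^esub> i\<in>B. pair (x i) q \<odot>\<^bsub>W\<^esub> y i)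
        \<in> generate (add_monoid W) ?G"
      using generate.eng[of _ "add_monoid W" ?G] insert by auto
    moreover have "(\<lambda>i. pair (x i) q \<odot>\<^bsub>W\<^esub> y i) \<in> insert i B \<rightarrow> carrier W"
      using insert q by (auto simp: x_closed y_closed pair_closed)
    ultimately show ?case
      using insert by simp
  qed
  from this[OF finite_index order_refl] show ?thesis
    using expand_right[of q] q unfolding ideal_smult_def by simp
qed

lemma ideal_smult_right_iff:
  assumes "ideal I R"
  shows "q \<in> ideal_smult I W \<longleftrightarrow> q \<in> carrier W \<and> (\<forall>v\<in>carrier V. pair v q \<in> I)"
  using ideal_smult_closed[OF assms] ideal_smultI x_closed by blast

lemma ideal_smult_left_iff:
  assumes "ideal I R"
  shows "v \<in> ideal_smult I V \<longleftrightarrow> v \<in> carrier V \<and> (\<forall>w\<in>carrier W. pair v w \<in> I)"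
  using dual_bases.ideal_smult_right_iff[OF swap assms] .

end

section \<open>Duals, automorphism groups and the algebra of transvections\<close>

lemma BijGroup_simps:
  "carrier (BijGroup S) = Bij S" "\<one>\<^bsub>BijGroup S\<^esub> = (\<lambda>p\<in>S. p)"
  "f \<in> Bij S \<Longrightarrow> g \<in> Bij S \<Longrightarrow> f \<otimes>\<^bsub>BijGroup S\<^esub> g = compose S f g"
  by (simp_all add: BijGroup_def)

context Module.module
begin

lemma dual_iff:
  "f \<in> carrier (dual R M) \<longleftrightarrow> f \<in> carrier M \<rightarrow>\<^sub>E carrier R \<and>
    (\<forall>p\<in>carrier M. \<forall>q\<in>carrier M. f (p \<oplus>\<^bsub>M\<^esub> q) = f p \<oplus> f q) \<and>
    (\<forall>a\<in>carrier R. \<forall>p\<in>carrier M. f (a \<odot>\<^bsub>M\<^esub> p) = a \<otimes> f p)"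
  by (simp add: dual_def lin_hom_def regular_module_def)

lemma dual_closed: "f \<in> carrier (dual R M) \<Longrightarrow> p \<in> carrier M \<Longrightarrow> f p \<in> carrier R"
  and dual_add: "f \<in> carrier (dual R M) \<Longrightarrow> p \<in> carrier M \<Longrightarrow> q \<in> carrier M \<Longrightarrow>
    f (p \<oplus>\<^bsub>M\<^esub> q) = f p \<oplus> f q"
  and dual_smult: "f \<in> carrier (dual R M) \<Longrightarrow> a \<in> carrier R \<Longrightarrow> p \<in> carrier M \<Longrightarrow>
    f (a \<odot>\<^bsub>M\<^esub> p) = a \<otimes> f p"
  by (auto simp: dual_iff)

lemma dual_eqI:
  assumes "f \<in> carrier (dual R M)" "g \<in> carrier (dual R M)" "\<And>p. p \<in> carrier M \<Longrightarrow> f p = g p"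
  shows "f = g"
  using assms by (auto simp: dual_iff intro: PiE_ext)

lemma dual_apply:
  "p \<in> carrier M \<Longrightarrow> (f \<oplus>\<^bsub>dual R M\<^esub> g) p = f p \<oplus> g p"
  "p \<in> carrier M \<Longrightarrow> (a \<odot>\<^bsub>dual R M\<^esub> f) p = a \<otimes> f p"
  "p \<in> carrier M \<Longrightarrow> \<zero>\<^bsub>dual R M\<^esub> p = \<zero>"
  by (simp_all add: dual_def)

lemma dual_op_closed:
  "f \<in> carrier (dual R M) \<Longrightarrow> g \<in> carrier (dual R M) \<Longrightarrow> f \<oplus>\<^bsub>dual R M\<^esub> g \<in> carrier (dual R M)"
  "a \<in> carrier R \<Longrightarrow> f \<in> carrier (dual R M) \<Longrightarrow> a \<odot>\<^bsub>dual R M\<^esub> f \<in> carrier (dual R M)"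
  "\<zero>\<^bsub>dual R M\<^esub> \<in> carrier (dual R M)"
proof -
  show "f \<oplus>\<^bsub>dual R M\<^esub> g \<in> carrier (dual R M)"
    if "f \<in> carrier (dual R M)" "g \<in> carrier (dual R M)"
    unfolding dual_iff using that
    by (auto simp: dual_apply dual_closed dual_add dual_smult R.a_ac R.r_distr)
      (simp_all add: dual_def)
  show "a \<odot>\<^bsub>dual R M\<^esub> f \<in> carrier (dual R M)" if "a \<in> carrier R" "f \<in> carrier (dual R M)"
    unfolding dual_iff using that
    by (auto simp: dual_apply dual_closed dual_add dual_smult R.m_lcomm R.r_distr)
      (simp_all add: dual_def)
  show "\<zero>\<^bsub>dual R M\<^esub> \<in> carrier (dual R M)"
    unfolding dual_iff by (auto simp: dual_apply) (simp_all add: dual_def)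
qed

lemma dual_module: "Module.module R (dual R M)"
proof (rule moduleI)
  show "cring R" ..
  show "abelian_group (dual R M)"
  proof (rule abelian_groupI)
    show "\<exists>g\<in>carrier (dual R M). g \<oplus>\<^bsub>dual R M\<^esub> f = \<zero>\<^bsub>dual R M\<^esub>" if "f \<in> carrier (dual R M)" for f
      using that
      by (intro bexI[of _ "(\<ominus> \<one>) \<odot>\<^bsub>dual R M\<^esub> f"] dual_eqI dual_op_closed)
        (auto simp: dual_apply dual_closed R.l_minus R.l_neg)
  qed (auto intro!: dual_eqI dual_op_closed simp: dual_apply dual_closed R.a_ac)
qed (auto intro!: dual_eqI dual_op_closed simp: dual_apply dual_closed R.l_distr R.r_distr R.m_assoc)

lemma dual_finsum_apply:
  assumes "finite B" "g \<in> B \<rightarrow> carrier (dual R M)" "p \<in> carrier M"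
  shows "(\<Oplus>\<^bsub>dual R M\<^esub> i\<in>B. g i) p = (\<Oplus> i\<in>B. g i p)"
proof -
  interpret D: Module.module R "dual R M"
    by (rule dual_module)
  show ?thesis
    using assms by (induction B) (auto simp: Pi_def dual_apply dual_closed)
qed

lemma lin_hom_finsum:
  assumes "Module.module R N" "f \<in> lin_hom R M N" "finite B" "g \<in> B \<rightarrow> carrier M"
  shows "f (\<Oplus>\<^bsub>M\<^esub> i\<in>B. g i) = (\<Oplus>\<^bsub>N\<^esub> i\<in>B. f (g i))"
proof -
  interpret N: Module.module R N
    by (rule assms(1))
  have closed: "f p \<in> carrier N" if "p \<in> carrier M" for p
    using assms(2) that by (auto simp: lin_hom_def)
  have "f (a \<odot>\<^bsub>M\<^esub> p) = a \<odot>\<^bsub>N\<^esub> f p" if "a \<in> carrier R" "p \<in> carrier M" for a p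
    using assms(2) that by (simp add: lin_hom_def)
  from this[of \<zero> "\<zero>\<^bsub>M\<^esub>"] have zero: "f \<zero>\<^bsub>M\<^esub> = \<zero>\<^bsub>N\<^esub>"
    using closed by simp
  have add: "f (p \<oplus>\<^bsub>M\<^esub> q) = f p \<oplus>\<^bsub>N\<^esub> f q" if "p \<in> carrier M" "q \<in> carrier M" for p q
    using assms(2) that by (simp add: lin_hom_def)
  show ?thesis
    using assms(3,4) by (induction B) (auto simp: Pi_def closed zero add)
qed

lemma dual_finsum:
  assumes "f \<in> carrier (dual R M)" "finite B" "g \<in> B \<rightarrow> carrier M"
  shows "f (\<Oplus>\<^bsub>M\<^esub> i\<in>B. g i) = (\<Oplus> i\<in>B. f (g i))"
proof -
  have "f \<zero>\<^bsub>M\<^esub> = \<zero>"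
    using assms(1) dual_smult[of f \<zero> "\<zero>\<^bsub>M\<^esub>"] by (simp add: dual_closed)
  with assms(2,3) show ?thesis
    by (induction B) (auto simp: Pi_def dual_closed[OF assms(1)] dual_add[OF assms(1)])
qed

lemma Aut_subgroup: "subgroup (lin_hom R M M \<inter> Bij (carrier M)) (BijGroup (carrier M))"
proof
  let ?S = "carrier M"
  show "lin_hom R M M \<inter> Bij ?S \<subseteq> carrier (BijGroup ?S)"
    by (simp add: BijGroup_simps)
  show "f \<otimes>\<^bsub>BijGroup ?S\<^esub> g \<in> lin_hom R M M \<inter> Bij ?S"
    if "f \<in> lin_hom R M M \<inter> Bij ?S" "g \<in> lin_hom R M M \<inter> Bij ?S" for f g
  proof -
    have "compose ?S f g \<in> Bij ?S"
      using that by (simp add: compose_Bij)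
    moreover have "g p \<in> ?S" if "p \<in> ?S" for p
      using that \<open>g \<in> lin_hom R M M \<inter> Bij ?S\<close> by (auto simp: lin_hom_def)
    ultimately show ?thesis
      using that by (auto simp: BijGroup_simps lin_hom_def compose_def)
  qed
  show "\<one>\<^bsub>BijGroup ?S\<^esub> \<in> lin_hom R M M \<inter> Bij ?S"
    by (auto simp: BijGroup_simps id_Bij lin_hom_def)
  show "inv\<^bsub>BijGroup ?S\<^esub> f \<in> lin_hom R M M \<inter> Bij ?S" if f: "f \<in> lin_hom R M M \<inter> Bij ?S" for f
  proof -
    let ?g = "inv_into ?S f"
    have bij: "bij_betw f ?S ?S"
      using f by (simp add: Bij_def)
    have g: "?g p \<in> ?S" "f (?g p) = p" if "p \<in> ?S" for p
      using that bij by (auto simp: bij_betw_def inv_into_into f_inv_into_f)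
    have eq: "?g p = q" if "q \<in> ?S" "f q = p" for p q
      using that bij by (auto simp: bij_betw_def inv_into_f_f)
    have "?g (p \<oplus>\<^bsub>M\<^esub> q) = ?g p \<oplus>\<^bsub>M\<^esub> ?g q" if "p \<in> ?S" "q \<in> ?S" for p q
      using that f g by (intro eq) (auto simp: lin_hom_def)
    moreover have "?g (a \<odot>\<^bsub>M\<^esub> p) = a \<odot>\<^bsub>M\<^esub> ?g p" if "a \<in> carrier R" "p \<in> ?S" for a p
      using that f g by (intro eq) (auto simp: lin_hom_def)
    ultimately show ?thesis
      using f restrict_inv_into_Bij[of f ?S] g by (simp add: inv_BijGroup lin_hom_def)
  qed
qed

lemma Aut_group: "group (Aut R M)"
  unfolding Aut_def by (rule subgroup.subgroup_is_group[OF Aut_subgroup group_BijGroup])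

lemma Aut_carrier: "carrier (Aut R M) = lin_hom R M M \<inter> Bij (carrier M)"
  by (simp add: Aut_def)

lemma Aut_apply_closed: "f \<in> carrier (Aut R M) \<Longrightarrow> p \<in> carrier M \<Longrightarrow> f p \<in> carrier M"
  by (auto simp: Aut_carrier lin_hom_def)

lemma Aut_linear:
  assumes "f \<in> carrier (Aut R M)"
  shows "p \<in> carrier M \<Longrightarrow> q \<in> carrier M \<Longrightarrow> f (p \<oplus>\<^bsub>M\<^esub> q) = f p \<oplus>\<^bsub>M\<^esub> f q"
    and "a \<in> carrier R \<Longrightarrow> p \<in> carrier M \<Longrightarrow> f (a \<odot>\<^bsub>M\<^esub> p) = a \<odot>\<^bsub>M\<^esub> f p"
  using assms by (auto simp: Aut_carrier lin_hom_def)

lemma Aut_mult_apply: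
  assumes "f \<in> carrier (Aut R M)" "g \<in> carrier (Aut R M)" "p \<in> carrier M"
  shows "(f \<otimes>\<^bsub>Aut R M\<^esub> g) p = f (g p)"
  using assms by (simp add: Aut_def BijGroup_simps compose_def)

lemma Aut_one_apply: "p \<in> carrier M \<Longrightarrow> \<one>\<^bsub>Aut R M\<^esub> p = p"
  by (simp add: Aut_def BijGroup_simps)

lemma Aut_eqI:
  assumes "f \<in> carrier (Aut R M)" "g \<in> carrier (Aut R M)" "\<And>p. p \<in> carrier M \<Longrightarrow> f p = g p"
  shows "f = g"
  using assms by (auto simp: Aut_carrier lin_hom_def intro: PiE_ext)

lemma Aut_inv_apply:
  assumes "f \<in> carrier (Aut R M)" "p \<in> carrier M"
  shows "(inv\<^bsub>Aut R M\<^esub> f) (f p) = p" "f ((inv\<^bsub>Aut R M\<^esub> f) p) = p"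
proof -
  interpret Aut: group "Aut R M"
    by (rule Aut_group)
  show "(inv\<^bsub>Aut R M\<^esub> f) (f p) = p" "f ((inv\<^bsub>Aut R M\<^esub> f) p) = p"
    using assms by (simp_all flip: Aut_mult_apply add: Aut_one_apply)
qed

lemma transvection_apply:
  "p \<in> carrier M \<Longrightarrow> transvection M f q p = p \<oplus>\<^bsub>M\<^esub> f p \<odot>\<^bsub>M\<^esub> q"
  by (simp add: transvection_def)

lemma transvection_transvection_apply:
  assumes "f \<in> carrier (dual R M)" "p \<in> carrier M" "q \<in> carrier M" "q' \<in> carrier M" "f q' = \<zero>"
  shows "transvection M f q (transvection M f q' p) = transvection M f (q' \<oplus>\<^bsub>M\<^esub> q) p"
  using assms
  by (simp add: transvection_apply dual_closed dual_add dual_smult smult_r_distr M.a_assoc)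

lemma transvection_zero_right:
  assumes "f \<in> carrier (dual R M)"
  shows "transvection M f \<zero>\<^bsub>M\<^esub> = \<one>\<^bsub>Aut R M\<^esub>"
  using assms by (auto simp: transvection_def Aut_def BijGroup_simps dual_closed)

lemma transvection_zero_left:
  assumes "q \<in> carrier M"
  shows "transvection M \<zero>\<^bsub>dual R M\<^esub> q = \<one>\<^bsub>Aut R M\<^esub>"
  using assms by (auto simp: transvection_def Aut_def BijGroup_simps dual_apply)

lemma transvection_in_Aut:
  assumes f: "f \<in> carrier (dual R M)" and q: "q \<in> carrier M" and fq: "f q = \<zero>"
  shows "transvection M f q \<in> carrier (Aut R M)"
proof -
  have closed: "transvection M f q' p \<in> carrier M" if "p \<in> carrier M" "q' \<in> carrier M" for p q'
    using that f by (simp add: transvection_apply dual_closed)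
  have "f ((\<ominus> \<one>) \<odot>\<^bsub>M\<^esub> q) = \<zero>"
    using f q fq by (simp add: dual_smult)
  then have minus: "f (\<ominus>\<^bsub>M\<^esub> q) = \<zero>"
    using q by (simp add: smult_l_minus)
  have "bij_betw (transvection M f q) (carrier M) (carrier M)"
    by (rule bij_betw_byWitness[where f' = "transvection M f (\<ominus>\<^bsub>M\<^esub> q)"])
      (use f q fq minus closed transvection_zero_right[OF f] in
        \<open>auto simp: transvection_transvection_apply M.l_neg M.r_neg Aut_one_apply\<close>)
  moreover have "transvection M f q \<in> extensional (carrier M)"
    by (simp add: transvection_def)
  moreover have "transvection M f q \<in> lin_hom R M M"
    using f q
    by (auto simp: lin_hom_def transvection_apply dual_closed dual_add dual_smult smult_l_distr
        smult_r_distr smult_assoc1 M.a_ac)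
      (simp add: transvection_def)
  ultimately show ?thesis
    by (simp add: Aut_carrier Bij_def)
qed

lemma transvection_add_right:
  assumes "f \<in> carrier (dual R M)" "q \<in> carrier M" "q' \<in> carrier M" "f q = \<zero>" "f q' = \<zero>"
  shows "transvection M f (q \<oplus>\<^bsub>M\<^esub> q') = transvection M f q \<otimes>\<^bsub>Aut R M\<^esub> transvection M f q'"
proof -
  interpret Aut: group "Aut R M"
    by (rule Aut_group)
  show ?thesis
    using assms
    by (intro Aut_eqI Aut.m_closed transvection_in_Aut)
      (auto simp: dual_add Aut_mult_apply transvection_in_Aut transvection_transvection_apply M.a_comm)
qed

lemma transvection_add_left:
  assumes "f \<in> carrier (dual R M)" "g \<in> carrier (dual R M)" "q \<in> carrier M" "f q = \<zero>" "g q = \<zero>"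
  shows "transvection M (f \<oplus>\<^bsub>dual R M\<^esub> g) q = transvection M f q \<otimes>\<^bsub>Aut R M\<^esub> transvection M g q"
proof -
  interpret Aut: group "Aut R M"
    by (rule Aut_group)
  show ?thesis
    using assms
    by (intro Aut_eqI Aut.m_closed transvection_in_Aut dual_op_closed)
      (auto simp: dual_apply Aut_mult_apply transvection_in_Aut transvection_apply
        dual_closed dual_add dual_smult smult_l_distr M.a_ac)
qed

lemma transvection_scale:
  assumes "a \<in> carrier R" "f \<in> carrier (dual R M)" "q \<in> carrier M"
  shows "transvection M (a \<odot>\<^bsub>dual R M\<^esub> f) q = transvection M f (a \<odot>\<^bsub>M\<^esub> q)"
  unfolding transvection_def using assms
  by (intro restrict_ext) (simp add: dual_apply dual_closed R.m_comm flip: smult_assoc1)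

lemma transvection_inv:
  assumes "f \<in> carrier (dual R M)" "q \<in> carrier M" "f q = \<zero>"
  shows "inv\<^bsub>Aut R M\<^esub> transvection M f q = transvection M f (\<ominus>\<^bsub>M\<^esub> q)"
    and "f (\<ominus>\<^bsub>M\<^esub> q) = \<zero>"
proof -
  interpret Aut: group "Aut R M"
    by (rule Aut_group)
  have "f ((\<ominus> \<one>) \<odot>\<^bsub>M\<^esub> q) = \<zero>"
    using assms by (simp add: dual_smult)
  then show minus: "f (\<ominus>\<^bsub>M\<^esub> q) = \<zero>"
    using assms by (simp add: smult_l_minus)
  show "inv\<^bsub>Aut R M\<^esub> transvection M f q = transvection M f (\<ominus>\<^bsub>M\<^esub> q)"
    using assms minus transvection_add_right[of f "\<ominus>\<^bsub>M\<^esub> q" q]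
    by (intro Aut.inv_equality) (auto simp: M.l_neg transvection_zero_right transvection_in_Aut)
qed

text \<open>With \<open>Y = g \<otimes> u\<close> and \<open>X = f \<otimes> e\<close> the hypotheses say that \<open>X X\<close>, \<open>Y Y\<close> and \<open>X Y\<close> vanish, and therefore
  \<open>(1 + Y) (1 + X) = (1 + Y X) (1 + X) (1 + Y)\<close>, where \<open>Y X\<close> is \<open>p \<mapsto> f p (g e) u\<close>.\<close>

lemma transvection_commutator:
  assumes f: "f \<in> carrier (dual R M)" and g: "g \<in> carrier (dual R M)"
    and u: "u \<in> carrier M" and e: "e \<in> carrier M"
    and zero: "f u = \<zero>" "f e = \<zero>" "g u = \<zero>"
  shows "transvection M (g e \<odot>\<^bsub>dual R M\<^esub> f) u =
    transvection M g u \<otimes>\<^bsub>Aut R M\<^esub> transvection M f e \<otimes>\<^bsub>Aut R M\<^esub>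
      inv\<^bsub>Aut R M\<^esub> transvection M g u \<otimes>\<^bsub>Aut R M\<^esub> inv\<^bsub>Aut R M\<^esub> transvection M f e"
    (is "?T = ?Y \<otimes>\<^bsub>_\<^esub> ?X \<otimes>\<^bsub>_\<^esub> inv\<^bsub>_\<^esub> ?Y \<otimes>\<^bsub>_\<^esub> inv\<^bsub>_\<^esub> ?X")
proof -
  interpret Aut: group "Aut R M"
    by (rule Aut_group)
  have X: "?X \<in> carrier (Aut R M)" and Y: "?Y \<in> carrier (Aut R M)"
    using assms by (auto intro: transvection_in_Aut)
  have T: "?T \<in> carrier (Aut R M)"
    using assms by (intro transvection_in_Aut dual_op_closed) (auto simp: dual_apply dual_closed)
  have "?T \<otimes>\<^bsub>Aut R M\<^esub> (?X \<otimes>\<^bsub>Aut R M\<^esub> ?Y) = ?Y \<otimes>\<^bsub>Aut R M\<^esub> ?X"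
  proof (rule Aut_eqI)
    fix p assume p: "p \<in> carrier M"
    have comm: "g e \<otimes> f p = f p \<otimes> g e"
      using assms p by (simp add: dual_closed R.m_comm)
    show "(?T \<otimes>\<^bsub>Aut R M\<^esub> (?X \<otimes>\<^bsub>Aut R M\<^esub> ?Y)) p = (?Y \<otimes>\<^bsub>Aut R M\<^esub> ?X) p"
      using assms p X Y T comm
      by (simp add: Aut_mult_apply transvection_apply dual_closed dual_add dual_smult dual_apply
          smult_l_distr M.a_ac)
  qed (use X Y T in auto)
  then have "?T = ?Y \<otimes>\<^bsub>Aut R M\<^esub> ?X \<otimes>\<^bsub>Aut R M\<^esub> inv\<^bsub>Aut R M\<^esub> (?X \<otimes>\<^bsub>Aut R M\<^esub> ?Y)"
    using X Y T by (metis Aut.inv_solve_right Aut.m_closed)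
  then show ?thesis
    using X Y by (simp add: Aut.inv_mult_group Aut.m_assoc)
qed

lemma transvection_commutator_mem:
  assumes H: "subgroup H (Aut R M)" and G: "subgroup G (Aut R M)"
    and conj: "\<And>g h. g \<in> G \<Longrightarrow> h \<in> H \<Longrightarrow> g \<otimes>\<^bsub>Aut R M\<^esub> h \<otimes>\<^bsub>Aut R M\<^esub> inv\<^bsub>Aut R M\<^esub> g \<in> H"
    and dual: "g \<in> carrier (dual R M)" "f \<in> carrier (dual R M)"
    and elems: "u \<in> carrier M" "e \<in> carrier M"
    and zero: "f u = \<zero>" "f e = \<zero>" "g u = \<zero>"
    and mem: "transvection M g u \<in> H \<and> transvection M f e \<in> G \<or>
      transvection M g u \<in> G \<and> transvection M f e \<in> H"
  shows "transvection M (g e \<odot>\<^bsub>dual R M\<^esub> f) u \<in> H"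
proof -
  interpret Aut: group "Aut R M"
    by (rule Aut_group)
  let ?Y = "transvection M g u" and ?X = "transvection M f e"
  have carr: "?X \<in> carrier (Aut R M)" "?Y \<in> carrier (Aut R M)"
    using dual elems zero by (auto intro: transvection_in_Aut)
  have eq: "transvection M (g e \<odot>\<^bsub>dual R M\<^esub> f) u =
      ?Y \<otimes>\<^bsub>Aut R M\<^esub> ?X \<otimes>\<^bsub>Aut R M\<^esub> inv\<^bsub>Aut R M\<^esub> ?Y \<otimes>\<^bsub>Aut R M\<^esub> inv\<^bsub>Aut R M\<^esub> ?X"
    using dual elems zero by (intro transvection_commutator)
  from mem show ?thesis
  proof
    assume "?Y \<in> H \<and> ?X \<in> G"
    then have "?Y \<otimes>\<^bsub>Aut R M\<^esub> (?X \<otimes>\<^bsub>Aut R M\<^esub> inv\<^bsub>Aut R M\<^esub> ?Y \<otimes>\<^bsub>Aut R M\<^esub> inv\<^bsub>Aut R M\<^esub> ?X) \<in> H"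
      using H conj by (simp add: subgroup.m_closed subgroup.m_inv_closed)
    then show ?thesis
      unfolding eq using carr by (simp add: Aut.m_assoc)
  next
    assume "?Y \<in> G \<and> ?X \<in> H"
    then show ?thesis
      unfolding eq using H conj by (simp add: subgroup.m_closed subgroup.m_inv_closed)
  qed
qed

lemma transvection_conj:
  assumes h: "h \<in> carrier (Aut R M)" and f: "f \<in> carrier (dual R M)" and q: "q \<in> carrier M"
    and fq: "f q = \<zero>"
  defines "f' \<equiv> compose (carrier M) f (inv\<^bsub>Aut R M\<^esub> h)"
  shows "h \<otimes>\<^bsub>Aut R M\<^esub> transvection M f q \<otimes>\<^bsub>Aut R M\<^esub> inv\<^bsub>Aut R M\<^esub> h = transvection M f' (h q)"
    and "f' \<in> carrier (dual R M)" and "f' (h q) = \<zero>"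
proof -
  interpret Aut: group "Aut R M"
    by (rule Aut_group)
  have h': "inv\<^bsub>Aut R M\<^esub> h \<in> carrier (Aut R M)"
    using h by simp
  have f'_apply: "f' p = f ((inv\<^bsub>Aut R M\<^esub> h) p)" if "p \<in> carrier M" for p
    using that by (simp add: f'_def compose_def)
  show f': "f' \<in> carrier (dual R M)"
    unfolding dual_iff using f Aut_apply_closed[OF h'] Aut_linear[OF h']
    by (auto simp: f'_apply dual_closed dual_add dual_smult) (simp add: f'_def compose_def)
  show fq': "f' (h q) = \<zero>"
    using Aut_apply_closed[OF h q] h q fq by (simp add: f'_apply Aut_inv_apply)
  show "h \<otimes>\<^bsub>Aut R M\<^esub> transvection M f q \<otimes>\<^bsub>Aut R M\<^esub> inv\<^bsub>Aut R M\<^esub> h = transvection M f' (h q)"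
    using h h' f q fq f' fq' Aut_apply_closed[OF h] Aut_apply_closed[OF h']
    by (intro Aut_eqI)
      (auto simp: transvection_in_Aut Aut_mult_apply transvection_apply Aut_linear dual_closed
        Aut_inv_apply f'_apply)
qed

end

section \<open>Transvections of a free module\<close>

locale free_module = Module.module R N
  for R :: "('a, 'r) ring_scheme" (structure) and N :: "('a, 'b, 'm) module_scheme" (structure) +
  fixes k :: nat and b :: "nat \<Rightarrow> 'b"
  assumes basis: "free_basis R N k b"
begin

definition coord :: "nat \<Rightarrow> 'b \<Rightarrow> 'a" where
  "coord i = (\<lambda>p\<in>carrier N. coords R N k b p i)"

lemma basis_closed: "i < k \<Longrightarrow> b i \<in> carrier N"
  using basis by (auto simp: free_basis_def)

lemma coord_closed: "i < k \<Longrightarrow> p \<in> carrier N \<Longrightarrow> coord i p \<in> carrier R"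
  and coord_expand: "p \<in> carrier N \<Longrightarrow> p = (\<Oplus>\<^bsub>N\<^esub> i\<in>{..<k}. coord i p \<odot>\<^bsub>N\<^esub> b i)"
proof -
  let ?c = "coords R N k b p"
  have *: "?c \<in> {..<k} \<rightarrow>\<^sub>E carrier R \<and> p = (\<Oplus>\<^bsub>N\<^esub> i\<in>{..<k}. ?c i \<odot>\<^bsub>N\<^esub> b i)" if "p \<in> carrier N"
  proof -
    have "\<exists>!c. c \<in> {..<k} \<rightarrow>\<^sub>E carrier R \<and> p = (\<Oplus>\<^bsub>N\<^esub> i\<in>{..<k}. c i \<odot>\<^bsub>N\<^esub> b i)"
      using basis that by (simp add: free_basis_def)
    from theI'[OF this] show ?thesis
      unfolding coords_def .
  qed
  show "coord i p \<in> carrier R" if "i < k" "p \<in> carrier N"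
    using * that by (auto simp: coord_def)
  show "p = (\<Oplus>\<^bsub>N\<^esub> i\<in>{..<k}. coord i p \<odot>\<^bsub>N\<^esub> b i)" if "p \<in> carrier N"
    using * that by (simp add: coord_def)
qed

lemma coord_eqI:
  assumes "c \<in> {..<k} \<rightarrow> carrier R" "i < k"
  shows "coord i (\<Oplus>\<^bsub>N\<^esub> j\<in>{..<k}. c j \<odot>\<^bsub>N\<^esub> b j) = c i"
proof -
  let ?p = "\<Oplus>\<^bsub>N\<^esub> j\<in>{..<k}. c j \<odot>\<^bsub>N\<^esub> b j"
  have c: "c j \<in> carrier R" if "j < k" for j
    using assms(1) that by auto
  have p: "?p \<in> carrier N"
    using c basis_closed by (intro M.finsum_closed) auto
  have eq: "?p = (\<Oplus>\<^bsub>N\<^esub> j\<in>{..<k}. restrict c {..<k} j \<odot>\<^bsub>N\<^esub> b j)"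
    using c basis_closed by (intro M.finsum_cong') auto
  have "coords R N k b ?p = restrict c {..<k}"
    unfolding coords_def
  proof (rule the1_equality)
    show "\<exists>!d. d \<in> {..<k} \<rightarrow>\<^sub>E carrier R \<and> ?p = (\<Oplus>\<^bsub>N\<^esub> j\<in>{..<k}. d j \<odot>\<^bsub>N\<^esub> b j)"
      using basis p by (simp add: free_basis_def)
    show "restrict c {..<k} \<in> {..<k} \<rightarrow>\<^sub>E carrier R \<and>
        ?p = (\<Oplus>\<^bsub>N\<^esub> j\<in>{..<k}. restrict c {..<k} j \<odot>\<^bsub>N\<^esub> b j)"
      using assms eq by auto
  qed
  then show ?thesis
    using p assms(2) by (simp add: coord_def)
qed

lemma coord_dual:
  assumes i: "i < k"
  shows "coord i \<in> carrier (dual R N)"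
proof -
  have "coord i (p \<oplus>\<^bsub>N\<^esub> q) = coord i p \<oplus> coord i q" if pq: "p \<in> carrier N" "q \<in> carrier N" for p q
  proof -
    have "p \<oplus>\<^bsub>N\<^esub> q =
        (\<Oplus>\<^bsub>N\<^esub> j\<in>{..<k}. coord j p \<odot>\<^bsub>N\<^esub> b j) \<oplus>\<^bsub>N\<^esub> (\<Oplus>\<^bsub>N\<^esub> j\<in>{..<k}. coord j q \<odot>\<^bsub>N\<^esub> b j)"
      using pq coord_expand by simp
    also have "\<dots> = (\<Oplus>\<^bsub>N\<^esub> j\<in>{..<k}. coord j p \<odot>\<^bsub>N\<^esub> b j \<oplus>\<^bsub>N\<^esub> coord j q \<odot>\<^bsub>N\<^esub> b j)"
      using pq coord_closed basis_closed by (intro M.finsum_addf[symmetric]) auto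
    also have "\<dots> = (\<Oplus>\<^bsub>N\<^esub> j\<in>{..<k}. (coord j p \<oplus> coord j q) \<odot>\<^bsub>N\<^esub> b j)"
      using pq coord_closed basis_closed by (intro M.finsum_cong') (auto simp: smult_l_distr)
    finally show ?thesis
      using coord_eqI[of "\<lambda>j. coord j p \<oplus> coord j q" i] i pq coord_closed by (simp add: Pi_def)
  qed
  moreover have "coord i (a \<odot>\<^bsub>N\<^esub> p) = a \<otimes> coord i p" if ap: "a \<in> carrier R" "p \<in> carrier N" for a p
  proof -
    have "a \<odot>\<^bsub>N\<^esub> p = a \<odot>\<^bsub>N\<^esub> (\<Oplus>\<^bsub>N\<^esub> j\<in>{..<k}. coord j p \<odot>\<^bsub>N\<^esub> b j)"
      using ap coord_expand by simp
    also have "\<dots> = (\<Oplus>\<^bsub>N\<^esub> j\<in>{..<k}. a \<odot>\<^bsub>N\<^esub> (coord j p \<odot>\<^bsub>N\<^esub> b j))"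
      using ap coord_closed basis_closed by (intro finsum_smult_ldistr) auto
    also have "\<dots> = (\<Oplus>\<^bsub>N\<^esub> j\<in>{..<k}. (a \<otimes> coord j p) \<odot>\<^bsub>N\<^esub> b j)"
      using ap coord_closed basis_closed by (intro M.finsum_cong') (auto simp: smult_assoc1)
    finally show ?thesis
      using coord_eqI[of "\<lambda>j. a \<otimes> coord j p" i] i ap coord_closed by (simp add: Pi_def)
  qed
  ultimately show ?thesis
    unfolding dual_iff using i coord_closed by (auto simp: coord_def)
qed

lemma coord_basis:
  assumes "i < k" "j < k"
  shows "coord i (b j) = (if i = j then \<one> else \<zero>)"
proof -
  have "(\<Oplus>\<^bsub>N\<^esub> l\<in>{..<k}. (if l = j then \<one> else \<zero>) \<odot>\<^bsub>N\<^esub> b l) =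
      (\<Oplus>\<^bsub>N\<^esub> l\<in>{..<k}. if l = j then b l else \<zero>\<^bsub>N\<^esub>)"
    using basis_closed by (intro M.finsum_cong') auto
  also have "\<dots> = b j"
    using assms basis_closed by (intro M.add.finprod_singleton_swap) auto
  finally show ?thesis
    using coord_eqI[of "\<lambda>l. if l = j then \<one> else \<zero>" i] assms by auto
qed

lemma dual_expand:
  assumes f: "f \<in> carrier (dual R N)" and p: "p \<in> carrier N"
  shows "f p = (\<Oplus> i\<in>{..<k}. f (b i) \<otimes> coord i p)"
proof -
  have "f p = f (\<Oplus>\<^bsub>N\<^esub> i\<in>{..<k}. coord i p \<odot>\<^bsub>N\<^esub> b i)"
    using coord_expand[OF p] by simp
  also have "\<dots> = (\<Oplus> i\<in>{..<k}. f (coord i p \<odot>\<^bsub>N\<^esub> b i))"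
    using p coord_closed basis_closed by (intro dual_finsum[OF f]) auto
  also have "\<dots> = (\<Oplus> i\<in>{..<k}. f (b i) \<otimes> coord i p)"
    using f p coord_closed basis_closed
    by (intro R.finsum_cong') (auto simp: dual_smult dual_closed R.m_comm)
  finally show ?thesis .
qed

sublocale dual: dual_bases R "dual R N" N "\<lambda>f p. f p" "{..<k}" coord b
proof (intro dual_bases.intro dual_bases_axioms.intro)
  show "Module.module R (dual R N)"
    by (rule dual_module)
  show "f = (\<Oplus>\<^bsub>dual R N\<^esub> i\<in>{..<k}. f (b i) \<odot>\<^bsub>dual R N\<^esub> coord i)" if f: "f \<in> carrier (dual R N)" for f
  proof -
    interpret D: Module.module R "dual R N"
      by (rule dual_module)
    have closed: "f (b i) \<odot>\<^bsub>dual R N\<^esub> coord i \<in> carrier (dual R N)" if "i < k" for i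
      using f that basis_closed coord_dual by (intro dual_op_closed) (auto simp: dual_closed)
    show ?thesis
    proof (rule dual_eqI[OF f])
      show "(\<Oplus>\<^bsub>dual R N\<^esub> i\<in>{..<k}. f (b i) \<odot>\<^bsub>dual R N\<^esub> coord i) \<in> carrier (dual R N)"
        using closed by (intro D.M.finsum_closed) auto
      show "f p = (\<Oplus>\<^bsub>dual R N\<^esub> i\<in>{..<k}. f (b i) \<odot>\<^bsub>dual R N\<^esub> coord i) p" if "p \<in> carrier N" for p
        using that closed dual_expand[OF f that] by (subst dual_finsum_apply) (auto simp: dual_apply)
    qed
  qed
qed (auto simp: dual_closed dual_add dual_smult dual_apply basis_closed coord_dual coord_basis
    is_cring module_axioms intro: coord_expand)

text \<open>By definition a functional is unimodular if an element of the bidual takes the value \<open>1\<close> on it. A free module of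
  finite rank is reflexive, so such an element is evaluation at a vector.\<close>

lemma Um_dual_iff:
  "f \<in> Um R (dual R N) \<longleftrightarrow> f \<in> carrier (dual R N) \<and> (\<exists>w\<in>carrier N. f w = \<one>)"
proof -
  have "\<exists>w\<in>carrier N. f w = \<one>"
    if f: "f \<in> carrier (dual R N)" and \<Phi>: "\<Phi> \<in> carrier (dual R (dual R N))" and 1: "\<Phi> f = \<one>" for \<Phi>
  proof
    let ?w = "\<Oplus>\<^bsub>N\<^esub> i\<in>{..<k}. \<Phi> (coord i) \<odot>\<^bsub>N\<^esub> b i"
    have c: "\<Phi> (coord i) \<in> carrier R" if "i < k" for i
      using \<Phi> that by (simp add: dual.V.dual_closed coord_dual)
    show "?w \<in> carrier N"
      using c basis_closed by (intro M.finsum_closed) auto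
    have "f ?w = (\<Oplus> i\<in>{..<k}. \<Phi> (coord i) \<otimes> f (b i))"
      using f c basis_closed
      by (subst dual_finsum) (auto intro!: R.finsum_cong' simp: dual_smult dual_closed)
    also have "\<dots> = (\<Oplus> i\<in>{..<k}. \<Phi> (f (b i) \<odot>\<^bsub>dual R N\<^esub> coord i))"
      using f \<Phi> c basis_closed coord_dual
      by (intro R.finsum_cong') (auto simp: dual.V.dual_smult dual_closed R.m_comm)
    also have "\<dots> = \<Phi> (\<Oplus>\<^bsub>dual R N\<^esub> i\<in>{..<k}. f (b i) \<odot>\<^bsub>dual R N\<^esub> coord i)"
      using f basis_closed coord_dual
      by (intro dual.V.dual_finsum[OF \<Phi>, symmetric]) (auto intro!: dual_op_closed simp: dual_closed)
    also have "\<dots> = \<one>"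
      using 1 dual.expand_left[OF f] by simp
    finally show "f ?w = \<one>" .
  qed
  moreover have "\<exists>\<Phi>\<in>carrier (dual R (dual R N)). \<Phi> f = \<one>"
    if "f \<in> carrier (dual R N)" "w \<in> carrier N" "f w = \<one>" for w
  proof
    show "(\<lambda>g\<in>carrier (dual R N). g w) \<in> carrier (dual R (dual R N))"
      unfolding dual.V.dual_iff using that
      by (auto simp: dual_closed dual_apply dual_op_closed)
    show "(\<lambda>g\<in>carrier (dual R N). g w) f = \<one>"
      using that by simp
  qed
  ultimately show ?thesis
    unfolding Um_def by blast
qed

definition elementary :: "'a set \<Rightarrow> ('b \<Rightarrow> 'b) set" where
  "elementary J =
    {transvection N (a \<odot>\<^bsub>dual R N\<^esub> coord i) (b j) | a i j. i < k \<and> j < k \<and> i \<noteq> j \<and> a \<in> J}"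

lemma elementary_in_Aut: "J \<subseteq> carrier R \<Longrightarrow> elementary J \<subseteq> carrier (Aut R N)"
  unfolding elementary_def
  by (auto intro!: transvection_in_Aut dual_op_closed
      simp: basis_closed coord_dual dual_apply coord_basis)

lemma rank_one_family_subgroup:
  assumes H: "subgroup H (Aut R N)" and J: "ideal J R" and el: "elementary J \<subseteq> H"
  shows "rank_one_family R (dual R N) N (\<lambda>f p. f p) {..<k} coord b (\<lambda>f q. transvection N f q \<in> H) J"
proof (intro rank_one_family.intro rank_one_family_axioms.intro)
  show "dual_bases R (dual R N) N (\<lambda>f p. f p) {..<k} coord b"
    by (rule dual.dual_bases_axioms)
qed (use H J el in \<open>auto simp: transvection_zero_left transvection_zero_right subgroup.one_closed
    transvection_add_left transvection_add_right subgroup.m_closed transvection_scale elementary_def\<close>)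

text \<open>Makes the results on pairings available for transvections; the commutator axiom holds because \<open>G\<close> normalises \<open>H\<close>.\<close>

lemma transvection_system_subgroup:
  assumes H: "subgroup H (Aut R N)" and G: "subgroup G (Aut R N)"
    and conj: "\<And>g h. g \<in> G \<Longrightarrow> h \<in> H \<Longrightarrow> g \<otimes>\<^bsub>Aut R N\<^esub> h \<otimes>\<^bsub>Aut R N\<^esub> inv\<^bsub>Aut R N\<^esub> g \<in> H"
    and J: "ideal J R" and el: "elementary J \<subseteq> H" "elementary (carrier R) \<subseteq> G"
  shows "transvection_system R (dual R N) N (\<lambda>f p. f p) {..<k} coord b
    (\<lambda>f q. transvection N f q \<in> H) (\<lambda>f q. transvection N f q \<in> G) J"
proof (intro transvection_system.intro transvection_system_axioms.intro)
  show "rank_one_family R (dual R N) N (\<lambda>f p. f p) {..<k} coord b (\<lambda>f q. transvection N f q \<in> H) J"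
    by (rule rank_one_family_subgroup[OF H J el(1)])
  show "rank_one_family R (dual R N) N (\<lambda>f p. f p) {..<k} coord b
      (\<lambda>f q. transvection N f q \<in> G) (carrier R)"
    by (rule rank_one_family_subgroup[OF G R.oneideal el(2)])
qed (rule transvection_commutator_mem[OF H G conj])

text \<open>The generators of \<open>Trans(N, IN)\<close>, with unimodularity and the conditions modulo \<open>I\<close> expressed by the values of
  functionals. Of the four combinations of a unimodularity condition with a condition modulo \<open>I\<close> only two are
  listed. In the other two the same object is unimodular and zero modulo \<open>I\<close>, which forces \<open>1 \<in> I\<close> and makes every
  condition modulo \<open>I\<close> true.\<close>

definition relative_transvections :: "'a set \<Rightarrow> ('b \<Rightarrow> 'b) set" where
  "relative_transvections I =
    {transvection N f q | f q. f \<in> carrier (dual R N) \<and> q \<in> carrier N \<and> f q = \<zero> \<and>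
      ((\<exists>g\<in>carrier (dual R N). g q = \<one>) \<and> (\<forall>p\<in>carrier N. f p \<in> I) \<or>
       (\<exists>w\<in>carrier N. f w = \<one>) \<and> (\<forall>g\<in>carrier (dual R N). g q \<in> I))}"

lemma relative_transvections_in_Aut: "relative_transvections I \<subseteq> carrier (Aut R N)"
  by (auto simp: relative_transvections_def intro: transvection_in_Aut)

text \<open>The group \<open>E(N, I)\<close> with which the three groups of the theorem are compared.\<close>

abbreviation relative_elementary :: "'a set \<Rightarrow> ('b \<Rightarrow> 'b) set" where
  "relative_elementary I \<equiv> relative_closure (Aut R N) (elementary (carrier R)) (elementary I)"

context
  fixes I assumes I: "ideal I R"
begin

lemma elementary_subset_generate: "elementary I \<subseteq> generate (Aut R N) (elementary (carrier R))"
proof -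
  have "I \<subseteq> carrier R"
    using I by (meson additive_subgroup.a_subset ideal.axioms(1))
  then show ?thesis
    by (auto simp: elementary_def intro!: generate.incl)
qed

lemma Trans_generators:
  "{transvection N f q | f q. (f, q) \<in> transvection_data R N \<and>
      (q \<in> ideal_smult I N \<or> f \<in> ideal_smult I (dual R N))} =
    relative_transvections I"
proof -
  have all: "a \<in> I" if "\<one> \<in> I" "a \<in> carrier R" for a
    using ideal.one_imp_carrier[OF I that(1)] that(2) by simp
  have "(f, q) \<in> transvection_data R N \<and> (q \<in> ideal_smult I N \<or> f \<in> ideal_smult I (dual R N)) \<longleftrightarrow>
      f \<in> carrier (dual R N) \<and> q \<in> carrier N \<and> f q = \<zero> \<and>
      ((\<exists>g\<in>carrier (dual R N). g q = \<one>) \<and> (\<forall>p\<in>carrier N. f p \<in> I) \<or>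
       (\<exists>w\<in>carrier N. f w = \<one>) \<and> (\<forall>g\<in>carrier (dual R N). g q \<in> I))" for f q
    unfolding transvection_data_def dual.ideal_smult_right_iff[OF I] dual.ideal_smult_left_iff[OF I]
      Um_dual_iff
    using all[OF _ dual_closed] by (simp add: Um_def) metis
  then show ?thesis
    unfolding relative_transvections_def by presburger
qed

text \<open>Conjugation by \<open>g\<close> replaces \<open>T f q\<close> by \<open>T (f \<circ> g\<inverse>) (g q)\<close>, and a witness \<open>f'\<close> or \<open>w\<close> of unimodularity by
  \<open>f' \<circ> g\<inverse>\<close> or \<open>g w\<close>.\<close>

lemma Trans_conj:
  assumes "g \<in> carrier (Aut R N)" "h \<in> Trans R I N"
  shows "g \<otimes>\<^bsub>Aut R N\<^esub> h \<otimes>\<^bsub>Aut R N\<^esub> inv\<^bsub>Aut R N\<^esub> g \<in> Trans R I N"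
proof -
  interpret Aut: group "Aut R N"
    by (rule Aut_group)
  have "Trans R I N \<lhd> Aut R N"
    unfolding Trans_def Trans_generators
  proof (rule Aut.normal_generateI)
    fix h g
    assume g: "g \<in> carrier (Aut R N)"
      and "h \<in> relative_transvections I"
    then obtain f q where h: "h = transvection N f q"
      and f: "f \<in> carrier (dual R N)" and q: "q \<in> carrier N" and fq: "f q = \<zero>"
      and fqI: "(\<exists>g\<in>carrier (dual R N). g q = \<one>) \<and> (\<forall>p\<in>carrier N. f p \<in> I) \<or>
       (\<exists>w\<in>carrier N. f w = \<one>) \<and> (\<forall>g\<in>carrier (dual R N). g q \<in> I)"
      unfolding relative_transvections_def by blast
    let ?g' = "inv\<^bsub>Aut R N\<^esub> g"
    have g': "?g' \<in> carrier (Aut R N)"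
      using g by simp
    have pull: "compose (carrier N) f' u \<in> carrier (dual R N)"
      if "f' \<in> carrier (dual R N)" "u \<in> carrier (Aut R N)" for f' u
      unfolding dual_iff using that Aut_apply_closed[OF that(2)] Aut_linear[OF that(2)]
      by (auto simp: compose_def dual_closed dual_add dual_smult)
    note conj = transvection_conj[OF g f q fq]
    have "(\<exists>f'\<in>carrier (dual R N). f' (g q) = \<one>) \<and> (\<forall>p\<in>carrier N. compose (carrier N) f ?g' p \<in> I) \<or>
       (\<exists>w\<in>carrier N. compose (carrier N) f ?g' w = \<one>) \<and> (\<forall>f'\<in>carrier (dual R N). f' (g q) \<in> I)"
      using fqI
    proof
      assume *: "(\<exists>f'\<in>carrier (dual R N). f' q = \<one>) \<and> (\<forall>p\<in>carrier N. f p \<in> I)"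
      then obtain f' where f': "f' \<in> carrier (dual R N)" "f' q = \<one>"
        by blast
      then have "compose (carrier N) f' ?g' (g q) = \<one>"
        using g q by (simp add: compose_def Aut_apply_closed Aut_inv_apply)
      moreover have "\<forall>p\<in>carrier N. compose (carrier N) f ?g' p \<in> I"
        using * g' by (simp add: compose_def Aut_apply_closed)
      ultimately show ?thesis
        using pull[OF f'(1) g'] by blast
    next
      assume *: "(\<exists>w\<in>carrier N. f w = \<one>) \<and> (\<forall>g\<in>carrier (dual R N). g q \<in> I)"
      then obtain w where w: "w \<in> carrier N" "f w = \<one>"
        by blast
      then have "compose (carrier N) f ?g' (g w) = \<one>"
        using g by (simp add: compose_def Aut_apply_closed Aut_inv_apply)
      moreover have "f' (g q) \<in> I" if "f' \<in> carrier (dual R N)" for f'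
      proof -
        have "compose (carrier N) f' g q \<in> I"
          using * pull[OF that g] by blast
        then show ?thesis
          using q by (simp add: compose_def)
      qed
      ultimately show ?thesis
        using Aut_apply_closed[OF g w(1)] by blast
    qed
    then show "g \<otimes>\<^bsub>Aut R N\<^esub> h \<otimes>\<^bsub>Aut R N\<^esub> ?g' \<in> relative_transvections I"
      unfolding h conj(1) relative_transvections_def
      using conj(2,3) Aut_apply_closed[OF g q] by blast
  qed (rule relative_transvections_in_Aut)
  then show ?thesis
    using assms by (rule normal.inv_op_closed2)
qed

theorem Trans_eq_relative_elementary:
  assumes k: "k \<ge> 3"
  shows "Trans R I N = relative_elementary I"
proof
  interpret Aut: group "Aut R N"
    by (rule Aut_group)
  note T = elementary_in_Aut[OF order_refl] and S = elementary_subset_generate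
  have IR: "a \<in> carrier R" if "a \<in> I" for a
    using I that by (meson additive_subgroup.a_Hcarr ideal.axioms(1))
  have card: "card {..<k} \<ge> 3"
    using k by simp
  interpret sys: transvection_system R "dual R N" N "\<lambda>f p. f p" "{..<k}" coord b
    "\<lambda>f q. transvection N f q \<in> relative_elementary I"
    "\<lambda>f q. transvection N f q \<in> generate (Aut R N) (elementary (carrier R))" I
    using Aut.relative_closure_subgroup[OF T S] Aut.generate_is_subgroup[OF T]
      Aut.relative_closure_conj[OF T S] I Aut.relative_closure_incl[OF T S]
    by (intro transvection_system_subgroup) (auto intro: generate.incl)
  show "Trans R I N \<subseteq> relative_elementary I"
    unfolding Trans_def Trans_generators
  proof (rule Aut.generate_subgroup_incl)
    show "subgroup (relative_elementary I) (Aut R N)"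
      by (rule Aut.relative_closure_subgroup[OF T S])
    show "relative_transvections I \<subseteq> relative_elementary I"
      using sys.unimodular_right[OF card] sys.unimodular_left[OF card] basis_closed coord_dual
      unfolding relative_transvections_def by blast
  qed
  show "relative_elementary I \<subseteq> Trans R I N"
  proof (rule Aut.relative_closure_least[OF T S])
    show "subgroup (Trans R I N) (Aut R N)"
      unfolding Trans_def Trans_generators
      by (intro Aut.generate_is_subgroup relative_transvections_in_Aut)
    show "elementary I \<subseteq> Trans R I N"
    proof
      fix h assume "h \<in> elementary I"
      then obtain a i j where h: "h = transvection N (a \<odot>\<^bsub>dual R N\<^esub> coord i) (b j)"
        and ij: "i < k" "j < k" "i \<noteq> j" and a: "a \<in> I"
        unfolding elementary_def by blast
      let ?f = "a \<odot>\<^bsub>dual R N\<^esub> coord i"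
      have "?f \<in> carrier (dual R N)" "b j \<in> carrier N" "?f (b j) = \<zero>" "coord j (b j) = \<one>"
        using ij a IR by (auto intro: dual_op_closed coord_dual basis_closed
          simp: dual_apply basis_closed coord_basis)
      moreover have "\<forall>p\<in>carrier N. ?f p \<in> I"
        using ij a I by (auto simp: dual_apply coord_closed ideal.I_r_closed)
      ultimately show "h \<in> Trans R I N"
        unfolding Trans_def Trans_generators relative_transvections_def h using ij coord_dual
        by (intro generate.incl) blast
    qed
    show "g \<otimes>\<^bsub>Aut R N\<^esub> h \<otimes>\<^bsub>Aut R N\<^esub> inv\<^bsub>Aut R N\<^esub> g \<in> Trans R I N"
      if "g \<in> generate (Aut R N) (elementary (carrier R))" "h \<in> Trans R I N" for g h
      using that Aut.generate_in_carrier[OF T] by (intro Trans_conj)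
  qed
qed

end
end

section \<open>Matrices of automorphisms\<close>

context free_module
begin

abbreviation to_mat :: "('b \<Rightarrow> 'b) \<Rightarrow> 'a mat" where
  "to_mat \<equiv> matrix_of R N k b"

abbreviation End :: "('b \<Rightarrow> 'b) set" where
  "End \<equiv> lin_hom R N N"

lemma End_simps:
  assumes "f \<in> End"
  shows "p \<in> carrier N \<Longrightarrow> f p \<in> carrier N"
    and "p \<in> carrier N \<Longrightarrow> q \<in> carrier N \<Longrightarrow> f (p \<oplus>\<^bsub>N\<^esub> q) = f p \<oplus>\<^bsub>N\<^esub> f q"
    and "a \<in> carrier R \<Longrightarrow> p \<in> carrier N \<Longrightarrow> f (a \<odot>\<^bsub>N\<^esub> p) = a \<odot>\<^bsub>N\<^esub> f p"
  using assms by (auto simp: lin_hom_def)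

lemma to_mat_index:
  "f \<in> End \<Longrightarrow> i < k \<Longrightarrow> j < k \<Longrightarrow> to_mat f $$ (i, j) = coord j (f (b i))"
  using End_simps(1) basis_closed by (simp add: matrix_of_def coord_def)

lemma to_mat_closed:
  assumes "f \<in> End"
  shows "to_mat f \<in> carrier (mat_monoid R k)"
proof -
  have "to_mat f \<in> carrier_mat k k"
    by (simp add: matrix_of_def)
  moreover from this have "elements_mat (to_mat f) \<subseteq> carrier R"
    using assms End_simps(1)[OF assms]
    by (auto dest!: elements_matD simp: to_mat_index coord_closed basis_closed)
  ultimately show ?thesis
    by (simp add: mat_monoid_def)
qed

lemma End_expand:
  assumes f: "f \<in> End" and p: "p \<in> carrier N"
  shows "f p = (\<Oplus>\<^bsub>N\<^esub> i\<in>{..<k}. coord i p \<odot>\<^bsub>N\<^esub> f (b i))"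
proof -
  have "f p = f (\<Oplus>\<^bsub>N\<^esub> i\<in>{..<k}. coord i p \<odot>\<^bsub>N\<^esub> b i)"
    using coord_expand[OF p] by simp
  also have "\<dots> = (\<Oplus>\<^bsub>N\<^esub> i\<in>{..<k}. f (coord i p \<odot>\<^bsub>N\<^esub> b i))"
    using p coord_closed basis_closed by (intro lin_hom_finsum[OF module_axioms f]) auto
  also have "\<dots> = (\<Oplus>\<^bsub>N\<^esub> i\<in>{..<k}. coord i p \<odot>\<^bsub>N\<^esub> f (b i))"
    using f p coord_closed basis_closed by (intro M.finsum_cong') (auto simp: End_simps)
  finally show ?thesis .
qed

text \<open>The order of the factors is reversed because matrices act on row vectors from the right.\<close>

lemma to_mat_compose:
  assumes f: "f \<in> End" and g: "g \<in> End"
  shows "compose (carrier N) f g \<in> End"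
    and "to_mat (compose (carrier N) f g) = to_mat g \<otimes>\<^bsub>mat_monoid R k\<^esub> to_mat f"
proof -
  show fg: "compose (carrier N) f g \<in> End"
    using End_simps[OF f] End_simps[OF g] by (simp add: lin_hom_def compose_def)
  show "to_mat (compose (carrier N) f g) = to_mat g \<otimes>\<^bsub>mat_monoid R k\<^esub> to_mat f"
  proof (rule eq_matI)
    fix i j assume "i < dim_row (to_mat g \<otimes>\<^bsub>mat_monoid R k\<^esub> to_mat f)"
      "j < dim_col (to_mat g \<otimes>\<^bsub>mat_monoid R k\<^esub> to_mat f)"
    then have ij: "i < k" "j < k"
      by (auto simp: mat_monoid_def)
    note closed = End_simps(1)[OF f] End_simps(1)[OF g] basis_closed coord_closed
    have "to_mat (compose (carrier N) f g) $$ (i, j) = coord j (f (g (b i)))"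
      using ij fg by (simp add: to_mat_index compose_def basis_closed)
    also have "\<dots> = coord j (\<Oplus>\<^bsub>N\<^esub> l\<in>{..<k}. coord l (g (b i)) \<odot>\<^bsub>N\<^esub> f (b l))"
      using End_expand[OF f, of "g (b i)"] closed ij by simp
    also have "\<dots> = (\<Oplus> l\<in>{..<k}. coord j (coord l (g (b i)) \<odot>\<^bsub>N\<^esub> f (b l)))"
      using closed ij by (intro dual_finsum coord_dual) auto
    also have "\<dots> = (\<Oplus> l\<in>{..<k}. to_mat g $$ (i, l) \<otimes> to_mat f $$ (l, j))"
      using closed ij f g
      by (intro R.finsum_cong') (auto simp: dual_smult[OF coord_dual] to_mat_index)
    finally show "to_mat (compose (carrier N) f g) $$ (i, j) =
        (to_mat g \<otimes>\<^bsub>mat_monoid R k\<^esub> to_mat f) $$ (i, j)"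
      using ij by (simp add: mat_monoid_def)
  qed (simp_all add: mat_monoid_def matrix_of_def)
qed

lemma to_mat_id:
  shows "(\<lambda>p\<in>carrier N. p) \<in> End" and "to_mat (\<lambda>p\<in>carrier N. p) = \<one>\<^bsub>mat_monoid R k\<^esub>"
proof -
  show id: "(\<lambda>p\<in>carrier N. p) \<in> End"
    by (simp add: lin_hom_def)
  show "to_mat (\<lambda>p\<in>carrier N. p) = \<one>\<^bsub>mat_monoid R k\<^esub>"
  proof (rule eq_matI)
    fix i j assume "i < dim_row \<one>\<^bsub>mat_monoid R k\<^esub>" "j < dim_col \<one>\<^bsub>mat_monoid R k\<^esub>"
    then have "i < k" "j < k"
      by (auto simp: mat_monoid_def)
    then show "to_mat (\<lambda>p\<in>carrier N. p) $$ (i, j) = \<one>\<^bsub>mat_monoid R k\<^esub> $$ (i, j)"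
      using id by (simp add: to_mat_index basis_closed coord_basis mat_monoid_def)
  qed (simp_all add: mat_monoid_def matrix_of_def)
qed

lemma to_mat_bij: "bij_betw to_mat End (carrier (mat_monoid R k))"
  unfolding bij_betw_def
proof
  show "inj_on to_mat End"
  proof (rule inj_onI)
    fix f g assume f: "f \<in> End" and g: "g \<in> End" and eq: "to_mat f = to_mat g"
    have "f (b i) = g (b i)" if i: "i < k" for i
    proof -
      have "coord j (f (b i)) = coord j (g (b i))" if "j < k" for j
        using to_mat_index[OF f i that] to_mat_index[OF g i that] eq by simp
      then have "(\<Oplus>\<^bsub>N\<^esub> j\<in>{..<k}. coord j (f (b i)) \<odot>\<^bsub>N\<^esub> b j) =
          (\<Oplus>\<^bsub>N\<^esub> j\<in>{..<k}. coord j (g (b i)) \<odot>\<^bsub>N\<^esub> b j)"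
        using i End_simps(1)[OF g] basis_closed coord_closed by (intro M.finsum_cong') auto
      then show ?thesis
        using i coord_expand End_simps(1)[OF f] End_simps(1)[OF g] basis_closed by metis
    qed
    then have "f p = g p" if "p \<in> carrier N" for p
      unfolding End_expand[OF f that] End_expand[OF g that]
      using that End_simps(1)[OF g] basis_closed coord_closed by (intro M.finsum_cong') auto
    then show "f = g"
      using f g by (auto simp: lin_hom_def intro: PiE_ext)
  qed
  show "to_mat ` End = carrier (mat_monoid R k)"
  proof
    show "to_mat ` End \<subseteq> carrier (mat_monoid R k)"
      using to_mat_closed by auto
    show "carrier (mat_monoid R k) \<subseteq> to_mat ` End"
    proof
      fix A assume A: "A \<in> carrier (mat_monoid R k)"
      have A_dim: "A \<in> carrier_mat k k"
        using A by (simp add: mat_monoid_def)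
      have A_closed: "A $$ (i, j) \<in> carrier R" if "i < k" "j < k" for i j
        using A elements_matI[OF A_dim that refl] by (auto simp: mat_monoid_def)
      define r where "r i = (\<Oplus>\<^bsub>N\<^esub> j\<in>{..<k}. A $$ (i, j) \<odot>\<^bsub>N\<^esub> b j)" for i
      have r: "r i \<in> carrier N" if "i < k" for i
        using that A_closed basis_closed unfolding r_def by (intro M.finsum_closed) auto
      define f where "f = (\<lambda>p\<in>carrier N. \<Oplus>\<^bsub>N\<^esub> i\<in>{..<k}. coord i p \<odot>\<^bsub>N\<^esub> r i)"
      have f_apply: "f p = (\<Oplus>\<^bsub>N\<^esub> i\<in>{..<k}. coord i p \<odot>\<^bsub>N\<^esub> r i)" if "p \<in> carrier N" for p
        using that by (simp add: f_def)
      have "f (p \<oplus>\<^bsub>N\<^esub> q) = f p \<oplus>\<^bsub>N\<^esub> f q" if "p \<in> carrier N" "q \<in> carrier N" for p q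
      proof -
        have "f (p \<oplus>\<^bsub>N\<^esub> q) = (\<Oplus>\<^bsub>N\<^esub> i\<in>{..<k}. coord i p \<odot>\<^bsub>N\<^esub> r i \<oplus>\<^bsub>N\<^esub> coord i q \<odot>\<^bsub>N\<^esub> r i)"
          unfolding f_apply[OF M.a_closed[OF that]] using that r coord_closed
          by (intro M.finsum_cong') (auto simp: dual_add[OF coord_dual] smult_l_distr)
        also have "\<dots> = f p \<oplus>\<^bsub>N\<^esub> f q"
          using that r coord_closed by (subst M.finsum_addf) (auto simp: f_apply)
        finally show ?thesis .
      qed
      moreover have "f (a \<odot>\<^bsub>N\<^esub> p) = a \<odot>\<^bsub>N\<^esub> f p" if "a \<in> carrier R" "p \<in> carrier N" for a p
      proof -
        have "f (a \<odot>\<^bsub>N\<^esub> p) = (\<Oplus>\<^bsub>N\<^esub> i\<in>{..<k}. a \<odot>\<^bsub>N\<^esub> (coord i p \<odot>\<^bsub>N\<^esub> r i))"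
          unfolding f_apply[OF smult_closed[OF that]] using that r coord_closed
          by (intro M.finsum_cong') (auto simp: dual_smult[OF coord_dual] smult_assoc1)
        also have "\<dots> = a \<odot>\<^bsub>N\<^esub> f p"
          using that r coord_closed by (subst finsum_smult_ldistr[symmetric]) (auto simp: f_apply)
        finally show ?thesis .
      qed
      moreover have "f p \<in> carrier N" if "p \<in> carrier N" for p
        using that r coord_closed unfolding f_def by (auto intro!: M.finsum_closed)
      ultimately have f: "f \<in> End"
        by (auto simp: lin_hom_def f_def)
      have fb: "f (b i) = r i" if i: "i < k" for i
      proof -
        have "f (b i) = (\<Oplus>\<^bsub>N\<^esub> l\<in>{..<k}. if l = i then r l else \<zero>\<^bsub>N\<^esub>)"
          using i r basis_closed unfolding f_def by (auto intro!: M.finsum_cong' simp: coord_basis)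
        also have "\<dots> = r i"
          using i r by (intro M.add.finprod_singleton_swap) auto
        finally show ?thesis .
      qed
      have "to_mat f = A"
      proof (rule eq_matI)
        fix i j assume "i < dim_row A" "j < dim_col A"
        then have ij: "i < k" "j < k"
          using A_dim by auto
        then show "to_mat f $$ (i, j) = A $$ (i, j)"
          using coord_eqI[of "\<lambda>j. A $$ (i, j)" j] A_closed by (auto simp: to_mat_index[OF f] fb r_def)
      qed (use A_dim in \<open>auto simp: matrix_of_def\<close>)
      then show "A \<in> to_mat ` End"
        using f by blast
    qed
  qed
qed

lemma mat_monoid_carrierE:
  assumes "A \<in> carrier (mat_monoid R k)"
  obtains f where "f \<in> End" "A = to_mat f"
  using assms to_mat_bij by (auto simp: bij_betw_def)

text \<open>The laws are transported from the composition of endomorphisms, which avoids manipulating the double sums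
  in a product of three matrices.\<close>

lemma mat_monoid: "monoid (mat_monoid R k)"
proof (rule monoidI)
  let ?M = "mat_monoid R k" and ?S = "carrier N"
  show "\<one>\<^bsub>?M\<^esub> \<in> carrier ?M"
    using to_mat_id to_mat_closed by metis
  fix A assume A: "A \<in> carrier ?M"
  then obtain f where f: "f \<in> End" "A = to_mat f"
    by (rule mat_monoid_carrierE)
  have ext: "f \<in> extensional ?S" and func: "f \<in> ?S \<rightarrow> ?S"
    using f by (auto simp: lin_hom_def PiE_def)
  have "to_mat (compose ?S f (\<lambda>p\<in>?S. p)) = to_mat f" "to_mat (compose ?S (\<lambda>p\<in>?S. p) f) = to_mat f"
    using ext func by simp_all
  then show "\<one>\<^bsub>?M\<^esub> \<otimes>\<^bsub>?M\<^esub> A = A" "A \<otimes>\<^bsub>?M\<^esub> \<one>\<^bsub>?M\<^esub> = A"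
    using f to_mat_id by (simp_all add: to_mat_compose)
  fix B assume B: "B \<in> carrier ?M"
  then obtain g where g: "g \<in> End" "B = to_mat g"
    by (rule mat_monoid_carrierE)
  show "A \<otimes>\<^bsub>?M\<^esub> B \<in> carrier ?M"
    using f g to_mat_closed[of "compose ?S g f"] by (simp add: to_mat_compose)
  fix C assume C: "C \<in> carrier ?M"
  then obtain h where h: "h \<in> End" "C = to_mat h"
    by (rule mat_monoid_carrierE)
  have "compose ?S h (compose ?S g f) = compose ?S (compose ?S h g) f"
    using func g h by (intro compose_assoc) (auto simp: lin_hom_def)
  from arg_cong[OF this, of to_mat] show "(A \<otimes>\<^bsub>?M\<^esub> B) \<otimes>\<^bsub>?M\<^esub> C = A \<otimes>\<^bsub>?M\<^esub> (B \<otimes>\<^bsub>?M\<^esub> C)"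
    using f g h by (simp add: to_mat_compose)
qed

lemma to_mat_mult:
  assumes "f \<in> carrier (Aut R N)" "g \<in> carrier (Aut R N)"
  shows "to_mat (f \<otimes>\<^bsub>Aut R N\<^esub> g) = to_mat g \<otimes>\<^bsub>GL R k\<^esub> to_mat f"
  using assms by (simp add: Aut_def BijGroup_simps to_mat_compose GL_def units_of_mult)

lemma to_mat_Aut: "to_mat ` carrier (Aut R N) = carrier (GL R k)"
proof
  interpret Aut: group "Aut R N"
    by (rule Aut_group)
  let ?S = "carrier N" and ?M = "mat_monoid R k"
  show "to_mat ` carrier (Aut R N) \<subseteq> carrier (GL R k)"
  proof clarify
    fix f assume f: "f \<in> carrier (Aut R N)"
    let ?g = "inv\<^bsub>Aut R N\<^esub> f"
    have g: "?g \<in> carrier (Aut R N)"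
      using f by simp
    have "to_mat f \<in> carrier ?M" "to_mat ?g \<in> carrier ?M"
      using f g to_mat_closed by (auto simp: Aut_carrier)
    moreover have "to_mat \<one>\<^bsub>Aut R N\<^esub> = \<one>\<^bsub>?M\<^esub>"
      using to_mat_id by (simp add: Aut_def BijGroup_simps)
    then have "to_mat f \<otimes>\<^bsub>?M\<^esub> to_mat ?g = \<one>\<^bsub>?M\<^esub>" "to_mat ?g \<otimes>\<^bsub>?M\<^esub> to_mat f = \<one>\<^bsub>?M\<^esub>"
      using f g to_mat_mult[of f ?g] to_mat_mult[of ?g f] by (auto simp: GL_def units_of_mult)
    ultimately show "to_mat f \<in> carrier (GL R k)"
      by (auto simp: GL_def units_of_carrier Units_def)
  qed
  show "carrier (GL R k) \<subseteq> to_mat ` carrier (Aut R N)"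
  proof
    fix A assume "A \<in> carrier (GL R k)"
    then obtain B where AB: "A \<in> carrier ?M" "B \<in> carrier ?M"
      "A \<otimes>\<^bsub>?M\<^esub> B = \<one>\<^bsub>?M\<^esub>" "B \<otimes>\<^bsub>?M\<^esub> A = \<one>\<^bsub>?M\<^esub>"
      by (auto simp: GL_def units_of_carrier Units_def)
    obtain f where f: "f \<in> End" "A = to_mat f"
      using AB(1) by (rule mat_monoid_carrierE)
    obtain g where g: "g \<in> End" "B = to_mat g"
      using AB(2) by (rule mat_monoid_carrierE)
    have "compose ?S g f = (\<lambda>p\<in>?S. p)" "compose ?S f g = (\<lambda>p\<in>?S. p)"
      using AB f g to_mat_id to_mat_bij
      by (auto intro!: inj_onD[of to_mat End] simp: to_mat_compose bij_betw_def)
    then have "g (f p) = p" "f (g p) = p" if "p \<in> ?S" for p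
      using that by (metis compose_eq restrict_apply')+
    then have "bij_betw f ?S ?S"
      using f g End_simps(1) by (intro bij_betw_byWitness[where f' = g]) auto
    then have "f \<in> carrier (Aut R N)"
      using f by (auto simp: Aut_carrier Bij_def lin_hom_def PiE_def)
    then show "A \<in> to_mat ` carrier (Aut R N)"
      using f by blast
  qed
qed

text \<open>Inversion undoes the reversal of products. As subgroups are closed under inverses, taking inverses first does
  not change the image of a subgroup.\<close>

lemma to_mat_inv_iso: "(\<lambda>f. to_mat (inv\<^bsub>Aut R N\<^esub> f)) \<in> iso (Aut R N) (GL R k)"
proof -
  interpret Aut: group "Aut R N"
    by (rule Aut_group)
  have "inj_on to_mat (carrier (Aut R N))"
    using to_mat_bij by (auto simp: bij_betw_def Aut_carrier inj_on_def)
  then have "bij_betw to_mat (carrier (Aut R N)) (carrier (GL R k))"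
    using to_mat_Aut by (simp add: bij_betw_def)
  moreover have "bij_betw (\<lambda>f. inv\<^bsub>Aut R N\<^esub> f) (carrier (Aut R N)) (carrier (Aut R N))"
    by (rule bij_betw_byWitness[where f' = "\<lambda>f. inv\<^bsub>Aut R N\<^esub> f"]) auto
  ultimately have "bij_betw (\<lambda>f. to_mat (inv\<^bsub>Aut R N\<^esub> f)) (carrier (Aut R N)) (carrier (GL R k))"
    using bij_betw_trans by (fastforce simp: o_def)
  moreover have "to_mat (inv\<^bsub>Aut R N\<^esub> (f \<otimes>\<^bsub>Aut R N\<^esub> g)) =
      to_mat (inv\<^bsub>Aut R N\<^esub> f) \<otimes>\<^bsub>GL R k\<^esub> to_mat (inv\<^bsub>Aut R N\<^esub> g)"
    if "f \<in> carrier (Aut R N)" "g \<in> carrier (Aut R N)" for f g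
    using that by (simp add: Aut.inv_mult_group to_mat_mult)
  ultimately show ?thesis
    by (auto simp: iso_def hom_def bij_betw_def)
qed

lemma to_mat_elementary:
  assumes "i < k" "j < k" "i \<noteq> j" "a \<in> carrier R"
  shows "to_mat (transvection N (a \<odot>\<^bsub>dual R N\<^esub> coord i) (b j)) = elem_mat R k i j a"
proof (rule eq_matI)
  let ?f = "transvection N (a \<odot>\<^bsub>dual R N\<^esub> coord i) (b j)"
  have f: "?f \<in> End"
    using assms transvection_in_Aut[of "a \<odot>\<^bsub>dual R N\<^esub> coord i" "b j"]
    by (simp add: dual_op_closed coord_dual basis_closed dual_apply coord_basis Aut_carrier)
  fix r s assume "r < dim_row (elem_mat R k i j a)" "s < dim_col (elem_mat R k i j a)"
  then have "r < k" "s < k"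
    by (auto simp: elem_mat_def)
  then show "to_mat ?f $$ (r, s) = elem_mat R k i j a $$ (r, s)"
    using assms
    by (auto simp: to_mat_index[OF f] transvection_apply basis_closed dual_apply coord_basis
        dual_add[OF coord_dual] dual_smult[OF coord_dual] elem_mat_def)
qed (simp_all add: matrix_of_def elem_mat_def)

lemma to_mat_inv_elementary:
  assumes J: "ideal J R"
  shows "(\<lambda>f. to_mat (inv\<^bsub>Aut R N\<^esub> f)) ` elementary J = elem_mats R k J"
proof -
  interpret J: ideal J R
    by (rule J)
  have inv: "to_mat (inv\<^bsub>Aut R N\<^esub> transvection N (a \<odot>\<^bsub>dual R N\<^esub> coord i) (b j)) =
      elem_mat R k i j (\<ominus> a)" if "i < k" "j < k" "i \<noteq> j" "a \<in> carrier R" for i j a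
  proof -
    have f: "a \<odot>\<^bsub>dual R N\<^esub> coord i \<in> carrier (dual R N)" "(a \<odot>\<^bsub>dual R N\<^esub> coord i) (b j) = \<zero>"
      using that by (auto simp: dual_op_closed coord_dual dual_apply basis_closed coord_basis)
    have "inv\<^bsub>Aut R N\<^esub> transvection N (a \<odot>\<^bsub>dual R N\<^esub> coord i) (b j) =
        transvection N (a \<odot>\<^bsub>dual R N\<^esub> coord i) (\<ominus>\<^bsub>N\<^esub> b j)"
      using transvection_inv(1)[OF f(1) _ f(2)] that basis_closed by simp
    also have "\<ominus>\<^bsub>N\<^esub> b j = (\<ominus> \<one>) \<odot>\<^bsub>N\<^esub> b j"
      using that basis_closed by (simp add: smult_l_minus)
    also have "transvection N (a \<odot>\<^bsub>dual R N\<^esub> coord i) ((\<ominus> \<one>) \<odot>\<^bsub>N\<^esub> b j) =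
        transvection N ((\<ominus> \<one>) \<odot>\<^bsub>dual R N\<^esub> (a \<odot>\<^bsub>dual R N\<^esub> coord i)) (b j)"
      using f that basis_closed by (intro transvection_scale[symmetric]) auto
    also have "(\<ominus> \<one>) \<odot>\<^bsub>dual R N\<^esub> (a \<odot>\<^bsub>dual R N\<^esub> coord i) = (\<ominus> a) \<odot>\<^bsub>dual R N\<^esub> coord i"
      using that coord_dual by (simp add: R.l_minus flip: dual.V.smult_assoc1)
    finally show ?thesis
      using that by (simp add: to_mat_elementary)
  qed
  show ?thesis
  proof
    show "(\<lambda>f. to_mat (inv\<^bsub>Aut R N\<^esub> f)) ` elementary J \<subseteq> elem_mats R k J"
      by (auto simp: elementary_def elem_mats_def inv J.a_Hcarr) (metis J.a_inv_closed)
    show "elem_mats R k J \<subseteq> (\<lambda>f. to_mat (inv\<^bsub>Aut R N\<^esub> f)) ` elementary J"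
    proof
      fix A assume "A \<in> elem_mats R k J"
      then obtain i j a where A: "A = elem_mat R k i j a" "i < k" "j < k" "i \<noteq> j" "a \<in> J"
        by (auto simp: elem_mats_def)
      then have "A = to_mat (inv\<^bsub>Aut R N\<^esub> transvection N ((\<ominus> a) \<odot>\<^bsub>dual R N\<^esub> coord i) (b j))"
        by (simp add: inv J.a_Hcarr)
      then show "A \<in> (\<lambda>f. to_mat (inv\<^bsub>Aut R N\<^esub> f)) ` elementary J"
        using A by (intro image_eqI) (auto simp: elementary_def)
    qed
  qed
qed

theorem to_mat_relative_elementary:
  assumes I: "ideal I R"
  shows "to_mat ` relative_elementary I = Elem_rel R I k"
proof -
  interpret Aut: group "Aut R N"
    by (rule Aut_group)
  note T = elementary_in_Aut[OF order_refl] and S = elementary_subset_generate[OF I]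
  have sub: "subgroup (relative_elementary I) (Aut R N)"
    by (rule Aut.relative_closure_subgroup[OF T S])
  have "group (GL R k)"
    unfolding GL_def by (rule monoid.units_group[OF mat_monoid])
  then have "(\<lambda>f. to_mat (inv\<^bsub>Aut R N\<^esub> f)) ` relative_elementary I =
      relative_closure (GL R k) (elem_mats R k (carrier R)) (elem_mats R k I)"
    using iso_image_relative_closure[OF to_mat_inv_iso Aut_group _ T S]
    by (simp add: to_mat_inv_elementary I R.oneideal)
  also have "\<dots> = Elem_rel R I k"
    by (simp add: relative_closure_def Elem_rel_def Elem_def)
  also have "(\<lambda>f. to_mat (inv\<^bsub>Aut R N\<^esub> f)) ` relative_elementary I =
      to_mat ` (\<lambda>f. inv\<^bsub>Aut R N\<^esub> f) ` relative_elementary I"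
    by (simp add: image_image)
  also have "(\<lambda>f. inv\<^bsub>Aut R N\<^esub> f) ` relative_elementary I = relative_elementary I"
  proof
    show "(\<lambda>f. inv\<^bsub>Aut R N\<^esub> f) ` relative_elementary I \<subseteq> relative_elementary I"
      using sub by (auto intro: subgroup.m_inv_closed)
    show "relative_elementary I \<subseteq> (\<lambda>f. inv\<^bsub>Aut R N\<^esub> f) ` relative_elementary I"
    proof
      fix f assume f: "f \<in> relative_elementary I"
      then have "f = inv\<^bsub>Aut R N\<^esub> (inv\<^bsub>Aut R N\<^esub> f)"
        using subgroup.mem_carrier[OF sub] by simp
      then show "f \<in> (\<lambda>f. inv\<^bsub>Aut R N\<^esub> f) ` relative_elementary I"
        using subgroup.m_inv_closed[OF sub f] by blast
    qed
  qed
  finally show ?thesis .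
qed

end

section \<open>Elementary transvections of a direct sum with the ring\<close>

locale ring_plus_free = M: free_module R M n b
  for R :: "('a, 'r) ring_scheme" (structure) and M :: "('a, 'b, 'm) module_scheme"
    and n :: nat and b :: "nat \<Rightarrow> 'b"
begin

abbreviation N :: "('a, 'a \<times> 'b) module" where
  "N \<equiv> ring_plus R M"

abbreviation B :: "nat \<Rightarrow> 'a \<times> 'b" where
  "B \<equiv> ring_plus_basis R M b"

lemma ring_plus_simps:
  "carrier N = carrier R \<times> carrier M"
  "(a, p) \<oplus>\<^bsub>N\<^esub> (a', p') = (a \<oplus> a', p \<oplus>\<^bsub>M\<^esub> p')"
  "c \<odot>\<^bsub>N\<^esub> (a, p) = (c \<otimes> a, c \<odot>\<^bsub>M\<^esub> p)"
  "\<zero>\<^bsub>N\<^esub> = (\<zero>, \<zero>\<^bsub>M\<^esub>)"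
  by (simp_all add: ring_plus_def direct_sum_def regular_module_def)

lemma B_simps: "B 0 = (\<one>, \<zero>\<^bsub>M\<^esub>)" "B (Suc i) = (\<zero>, b i)"
  by (simp_all add: ring_plus_basis_def)

lemma ring_plus_module: "Module.module R N"
proof (rule moduleI)
  show "cring R" ..
  show "abelian_group N"
  proof (rule abelian_groupI)
    show "\<exists>v\<in>carrier N. v \<oplus>\<^bsub>N\<^esub> u = \<zero>\<^bsub>N\<^esub>" if mem: "u \<in> carrier N" for u
    proof -
      obtain a p where "u = (a, p)" "a \<in> carrier R" "p \<in> carrier M"
        using mem by (cases u) (auto simp: ring_plus_simps)
      then show ?thesis
        by (intro bexI[of _ "(\<ominus> a, \<ominus>\<^bsub>M\<^esub> p)"])
          (auto simp: ring_plus_simps M.R.l_neg M.M.l_neg)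
    qed
  qed (auto simp: ring_plus_simps M.R.a_ac M.M.a_ac)
qed (auto simp: ring_plus_simps M.R.l_distr M.R.r_distr M.R.m_assoc M.smult_l_distr
    M.smult_r_distr M.smult_assoc1)

interpretation N: Module.module R N
  by (rule ring_plus_module)

lemma finsum_Pair:
  assumes "finite A" "f \<in> A \<rightarrow> carrier R" "g \<in> A \<rightarrow> carrier M"
  shows "(\<Oplus>\<^bsub>N\<^esub> i\<in>A. (f i, g i)) = (\<Oplus> i\<in>A. f i, \<Oplus>\<^bsub>M\<^esub> i\<in>A. g i)"
  using assms by (induction A) (auto simp: Pi_def ring_plus_simps)

lemma B_sum:
  assumes c: "c \<in> {..<Suc n} \<rightarrow> carrier R"
  shows "(\<Oplus>\<^bsub>N\<^esub> i\<in>{..<Suc n}. c i \<odot>\<^bsub>N\<^esub> B i) = (c 0, \<Oplus>\<^bsub>M\<^esub> i\<in>{..<n}. c (Suc i) \<odot>\<^bsub>M\<^esub> b i)"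
proof -
  have c: "c 0 \<in> carrier R" "\<And>i. i < n \<Longrightarrow> c (Suc i) \<in> carrier R"
    using c by auto
  have B: "B i \<in> carrier N" if "i < Suc n" for i
    using that M.basis_closed by (cases i) (auto simp: B_simps ring_plus_simps)
  have "(\<Oplus>\<^bsub>N\<^esub> i\<in>{..<Suc n}. c i \<odot>\<^bsub>N\<^esub> B i) =
      c 0 \<odot>\<^bsub>N\<^esub> B 0 \<oplus>\<^bsub>N\<^esub> (\<Oplus>\<^bsub>N\<^esub> i\<in>Suc ` {..<n}. c i \<odot>\<^bsub>N\<^esub> B i)"
    unfolding lessThan_Suc_eq_insert_0 using c B by (intro N.M.finsum_insert) auto
  also have "(\<Oplus>\<^bsub>N\<^esub> i\<in>Suc ` {..<n}. c i \<odot>\<^bsub>N\<^esub> B i) = (\<Oplus>\<^bsub>N\<^esub> i\<in>{..<n}. c (Suc i) \<odot>\<^bsub>N\<^esub> B (Suc i))"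
    using c B by (intro N.M.add.finprod_reindex) auto
  also have "\<dots> = (\<Oplus>\<^bsub>N\<^esub> i\<in>{..<n}. (\<zero>, c (Suc i) \<odot>\<^bsub>M\<^esub> b i))"
    using c M.basis_closed by (intro N.M.finsum_cong') (auto simp: B_simps ring_plus_simps)
  also have "\<dots> = (\<zero>, \<Oplus>\<^bsub>M\<^esub> i\<in>{..<n}. c (Suc i) \<odot>\<^bsub>M\<^esub> b i)"
    using c M.basis_closed by (subst finsum_Pair) auto
  also have "c 0 \<odot>\<^bsub>N\<^esub> B 0 \<oplus>\<^bsub>N\<^esub> (\<zero>, \<Oplus>\<^bsub>M\<^esub> i\<in>{..<n}. c (Suc i) \<odot>\<^bsub>M\<^esub> b i) =
      (c 0, \<Oplus>\<^bsub>M\<^esub> i\<in>{..<n}. c (Suc i) \<odot>\<^bsub>M\<^esub> b i)"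
    using c M.basis_closed by (simp add: B_simps ring_plus_simps Pi_def)
  finally show ?thesis .
qed

lemma ring_plus_free_basis: "free_basis R N (Suc n) B"
proof -
  have "B \<in> {..<Suc n} \<rightarrow> carrier N"
  proof
    fix i assume "i \<in> {..<Suc n}"
    then show "B i \<in> carrier N"
      using M.basis_closed by (cases i) (auto simp: B_simps ring_plus_simps)
  qed
  moreover have "\<exists>!c. c \<in> {..<Suc n} \<rightarrow>\<^sub>E carrier R \<and> u = (\<Oplus>\<^bsub>N\<^esub> i\<in>{..<Suc n}. c i \<odot>\<^bsub>N\<^esub> B i)"
    if mem: "u \<in> carrier N" for u
  proof -
    obtain a p where u: "u = (a, p)" and a: "a \<in> carrier R" and p: "p \<in> carrier M"
      using mem by (cases u) (auto simp: ring_plus_simps)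
    define c where "c = (\<lambda>i\<in>{..<Suc n}. case i of 0 \<Rightarrow> a | Suc j \<Rightarrow> M.coord j p)"
    have c: "c \<in> {..<Suc n} \<rightarrow>\<^sub>E carrier R"
      using a p M.coord_closed by (auto simp: c_def split: nat.split)
    have "p = (\<Oplus>\<^bsub>M\<^esub> i\<in>{..<n}. c (Suc i) \<odot>\<^bsub>M\<^esub> b i)"
      using M.coord_expand[OF p] M.coord_closed M.basis_closed p
      by (subst M.M.finsum_cong'[of _ _ "\<lambda>i. M.coord i p \<odot>\<^bsub>M\<^esub> b i"]) (auto simp: c_def)
    then have "u = (\<Oplus>\<^bsub>N\<^esub> i\<in>{..<Suc n}. c i \<odot>\<^bsub>N\<^esub> B i)"
      using c by (subst B_sum) (auto simp: u c_def)
    moreover have "d = c"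
      if d: "d \<in> {..<Suc n} \<rightarrow>\<^sub>E carrier R" "u = (\<Oplus>\<^bsub>N\<^esub> i\<in>{..<Suc n}. d i \<odot>\<^bsub>N\<^esub> B i)" for d
    proof (rule PiE_ext[OF d(1) c])
      have d': "(\<lambda>i. d (Suc i)) \<in> {..<n} \<rightarrow> carrier R"
        using d by auto
      have "d \<in> {..<Suc n} \<rightarrow> carrier R"
        using d(1) by auto
      from d(2)[unfolded B_sum[OF this] u]
      have da: "d 0 = a" and dp: "p = (\<Oplus>\<^bsub>M\<^esub> i\<in>{..<n}. d (Suc i) \<odot>\<^bsub>M\<^esub> b i)"
        by auto
      show "d i = c i" if "i \<in> {..<Suc n}" for i
        using that da M.coord_eqI[OF d'] dp by (cases i) (auto simp: c_def)
    qed
    ultimately show ?thesis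
      using c by blast
  qed
  ultimately show ?thesis
    by (simp add: free_basis_def)
qed

sublocale N: free_module R N "Suc n" B
  using ring_plus_module ring_plus_free_basis by (simp add: free_module_def free_module_axioms_def)

lemma N_coord:
  assumes "a \<in> carrier R" "p \<in> carrier M"
  shows "N.coord 0 (a, p) = a" and "i < n \<Longrightarrow> N.coord (Suc i) (a, p) = M.coord i p"
proof -
  have u: "(a, p) \<in> carrier N"
    using assms by (simp add: ring_plus_simps)
  have c: "N.coord j (a, p) \<in> carrier R" if "j < Suc n" for j
    using N.coord_closed[OF that u] .
  then have "(\<lambda>j. N.coord j (a, p)) \<in> {..<Suc n} \<rightarrow> carrier R"
    by auto
  from N.coord_expand[OF u, unfolded B_sum[OF this]]
  have *: "N.coord 0 (a, p) = a"
    "p = (\<Oplus>\<^bsub>M\<^esub> i\<in>{..<n}. N.coord (Suc i) (a, p) \<odot>\<^bsub>M\<^esub> b i)"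
    by auto
  show "N.coord 0 (a, p) = a"
    by (rule *)
  show "N.coord (Suc i) (a, p) = M.coord i p" if "i < n"
    using M.coord_eqI[of "\<lambda>i. N.coord (Suc i) (a, p)" i] that c *(2) by auto
qed

text \<open>The functional \<open>(0, \<tau>)\<close> on \<open>R \<oplus> M\<close>.\<close>

definition extend :: "('b \<Rightarrow> 'a) \<Rightarrow> 'a \<times> 'b \<Rightarrow> 'a" where
  "extend \<tau> = (\<lambda>u\<in>carrier N. \<tau> (snd u))"

lemma extend_dual: "\<tau> \<in> carrier (dual R M) \<Longrightarrow> extend \<tau> \<in> carrier (dual R N)"
  unfolding N.dual_iff
  by (auto simp: extend_def ring_plus_simps M.dual_closed M.dual_add M.dual_smult)

lemma extend_apply: "a \<in> carrier R \<Longrightarrow> p \<in> carrier M \<Longrightarrow> extend \<tau> (a, p) = \<tau> p"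
  by (simp add: extend_def ring_plus_simps)

lemma elem_trans_eq:
  assumes "x \<in> carrier M"
  shows "elem_trans R M x = transvection N (N.coord 0) (\<zero>, x)"
  unfolding elem_trans_def transvection_def using assms
  by (intro restrict_ext) (auto simp: ring_plus_simps N_coord)

lemma elem_trans_dual_eq:
  assumes "\<tau> \<in> carrier (dual R M)"
  shows "elem_trans_dual R M \<tau> = transvection N (extend \<tau>) (B 0)"
  unfolding elem_trans_dual_def transvection_def using assms
  by (intro restrict_ext) (auto simp: ring_plus_simps B_simps extend_apply M.dual_closed)

abbreviation elem_transvections :: "'a set \<Rightarrow> ('a \<times> 'b \<Rightarrow> 'a \<times> 'b) set" where
  "elem_transvections J \<equiv>
    elem_trans R M ` ideal_smult J M \<union> elem_trans_dual R M ` ideal_smult J (dual R M)"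

lemma ideal_smult_carrier:
  "ideal_smult (carrier R) M = carrier M"
  "ideal_smult (carrier R) (dual R M) = carrier (dual R M)"
  using M.dual.ideal_smult_right_iff[OF M.R.oneideal] M.dual.ideal_smult_left_iff[OF M.R.oneideal]
  by (auto simp: M.dual_closed)

lemma elem_transvections_in_Aut:
  assumes "ideal J R"
  shows "elem_transvections J \<subseteq> carrier (Aut R N)"
proof -
  have "elem_trans R M x \<in> carrier (Aut R N)" if "x \<in> carrier M" for x
    unfolding elem_trans_eq[OF that] using that N.coord_dual[of 0]
    by (intro N.transvection_in_Aut) (auto simp: ring_plus_simps N_coord)
  moreover have "elem_trans_dual R M \<tau> \<in> carrier (Aut R N)" if "\<tau> \<in> carrier (dual R M)" for \<tau>
  proof -
    have "\<tau> \<zero>\<^bsub>M\<^esub> = \<zero>"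
      by (rule M.dual.pair_zero_right[OF that])
    then show ?thesis
      unfolding elem_trans_dual_eq[OF that] using that extend_dual N.basis_closed[of 0]
      by (intro N.transvection_in_Aut) (auto simp: B_simps extend_apply)
  qed
  ultimately show ?thesis
    using M.dual.ideal_smult_right_iff[OF assms] M.dual.ideal_smult_left_iff[OF assms] by auto
qed

text \<open>Expand the vector \<open>(0, x)\<close>, or the functional \<open>(0, \<tau>)\<close>, in coordinates and use additivity: all coefficients lie in
  \<open>J\<close>, and the coefficient with index \<open>0\<close>, which would not belong to an elementary transvection, vanishes.\<close>

lemma elem_transvections_subset:
  assumes H: "subgroup H (Aut R N)" and J: "ideal J R" and el: "N.elementary J \<subseteq> H"
  shows "elem_transvections J \<subseteq> H"
proof -
  interpret H: rank_one_family R "dual R N" N "\<lambda>f p. f p" "{..<Suc n}" N.coord B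
    "\<lambda>f q. transvection N f q \<in> H" J
    by (rule N.rank_one_family_subgroup[OF H J el])
  have "elem_trans R M x \<in> H" if x: "x \<in> ideal_smult J M" for x
  proof -
    have xM: "x \<in> carrier M" and xJ: "\<And>i. i < n \<Longrightarrow> M.coord i x \<in> J"
      using x M.coord_dual by (auto simp: M.dual.ideal_smult_right_iff[OF J])
    have u: "(\<zero>, x) \<in> carrier N"
      using xM by (simp add: ring_plus_simps)
    have c: "N.coord i (\<zero>, x) \<in> carrier R" if "i < Suc n" for i
      using N.coord_closed[OF that u] .
    have "transvection N (N.coord 0) (\<Oplus>\<^bsub>N\<^esub> i\<in>{..<Suc n}. N.coord i (\<zero>, x) \<odot>\<^bsub>N\<^esub> B i) \<in> H"
    proof (rule H.sum_right)
      fix i assume i: "i \<in> {..<Suc n}"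
      have "N.coord 0 (N.coord i (\<zero>, x) \<odot>\<^bsub>N\<^esub> B i) = \<zero> \<and>
        transvection N (N.coord 0) (N.coord i (\<zero>, x) \<odot>\<^bsub>N\<^esub> B i) \<in> H"
      proof (cases i)
        case 0
        then have "N.coord i (\<zero>, x) \<odot>\<^bsub>N\<^esub> B i = \<zero>\<^bsub>N\<^esub>"
          using i xM N.basis_closed by (simp add: N_coord)
        then show ?thesis
          using N.coord_dual[of 0] N.dual.pair_zero_right[of "N.coord 0"] H.zero_right by simp
      next
        case (Suc j)
        then have "N.coord i (\<zero>, x) \<in> J"
          using i xM xJ by (simp add: N_coord)
        moreover have "N.coord 0 (N.coord i (\<zero>, x) \<odot>\<^bsub>N\<^esub> B i) = \<zero>"
          using i Suc c N.coord_dual[of 0] N.basis_closed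
          by (simp add: N.dual_smult N.coord_basis)
        ultimately show ?thesis
          using i Suc c H.elem[of 0 i "N.coord i (\<zero>, x)"]
            H.scale[of "N.coord i (\<zero>, x)" "N.coord 0" "B i"] N.coord_dual[of 0] N.basis_closed
          by simp
      qed
      then show "N.coord 0 (N.coord i (\<zero>, x) \<odot>\<^bsub>N\<^esub> B i) = \<zero>"
        "transvection N (N.coord 0) (N.coord i (\<zero>, x) \<odot>\<^bsub>N\<^esub> B i) \<in> H"
        by auto
    qed (use N.coord_dual c N.basis_closed in auto)
    then show ?thesis
      using N.coord_expand[OF u] by (simp add: elem_trans_eq[OF xM])
  qed
  moreover have "elem_trans_dual R M \<tau> \<in> H" if \<tau>: "\<tau> \<in> ideal_smult J (dual R M)" for \<tau>
  proof -
    have \<tau>M: "\<tau> \<in> carrier (dual R M)" and \<tau>J: "\<And>i. i < n \<Longrightarrow> \<tau> (b i) \<in> J"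
      using \<tau> M.basis_closed by (auto simp: M.dual.ideal_smult_left_iff[OF J])
    note f = extend_dual[OF \<tau>M]
    have f0: "extend \<tau> (B 0) = \<zero>"
      using M.dual.pair_zero_right[OF \<tau>M] by (simp add: B_simps extend_apply)
    have c: "extend \<tau> (B i) \<in> carrier R" if "i < Suc n" for i
      using N.dual_closed[OF f N.basis_closed[OF that]] .
    have B0: "B 0 \<in> carrier N"
      by (simp add: N.basis_closed)
    have "transvection N (\<Oplus>\<^bsub>dual R N\<^esub> i\<in>{..<Suc n}. extend \<tau> (B i) \<odot>\<^bsub>dual R N\<^esub> N.coord i) (B 0) \<in> H"
    proof (rule H.sum_left)
      fix i assume i: "i \<in> {..<Suc n}"
      have "(extend \<tau> (B i) \<odot>\<^bsub>dual R N\<^esub> N.coord i) (B 0) = \<zero> \<and>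
        transvection N (extend \<tau> (B i) \<odot>\<^bsub>dual R N\<^esub> N.coord i) (B 0) \<in> H"
      proof (cases i)
        case 0
        then have "extend \<tau> (B i) \<odot>\<^bsub>dual R N\<^esub> N.coord i = \<zero>\<^bsub>dual R N\<^esub>"
          using f0 N.coord_dual[of 0] by simp
        then show ?thesis
          using B0 H.zero_left by (simp add: N.dual_apply)
      next
        case (Suc j)
        then have "extend \<tau> (B i) \<in> J"
          using i \<tau>J M.basis_closed by (simp add: B_simps extend_apply)
        then show ?thesis
          using i Suc c B0 H.elem[of i 0 "extend \<tau> (B i)"]
          by (simp add: N.dual_apply N.coord_basis)
      qed
      then show "(extend \<tau> (B i) \<odot>\<^bsub>dual R N\<^esub> N.coord i) (B 0) = \<zero>"
        "transvection N (extend \<tau> (B i) \<odot>\<^bsub>dual R N\<^esub> N.coord i) (B 0) \<in> H"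
        by auto
    qed (use N.coord_dual c B0 in \<open>auto intro!: N.dual_op_closed\<close>)
    then show ?thesis
      using N.dual.expand_left[OF f] by (simp add: elem_trans_dual_eq[OF \<tau>M])
  qed
  ultimately show ?thesis
    by blast
qed

text \<open>For \<open>i, j \<noteq> 0\<close> the elementary transvection with indices \<open>i\<close> and \<open>j\<close> is the commutator of
  those with indices \<open>(0, j)\<close> and \<open>(i, 0)\<close>. Only the second one carries the coefficient from \<open>J\<close>, whence the role
  of \<open>G\<close>. With \<open>G = H\<close> and \<open>J = R\<close> the lemma also covers the absolute groups.\<close>

lemma elementary_subset:
  assumes H: "subgroup H (Aut R N)" and G: "subgroup G (Aut R N)"
    and conj: "\<And>g h. g \<in> G \<Longrightarrow> h \<in> H \<Longrightarrow> g \<otimes>\<^bsub>Aut R N\<^esub> h \<otimes>\<^bsub>Aut R N\<^esub> inv\<^bsub>Aut R N\<^esub> g \<in> H"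
    and J: "ideal J R" and JH: "elem_transvections J \<subseteq> H"
    and TG: "elem_transvections (carrier R) \<subseteq> G"
  shows "N.elementary J \<subseteq> H"
proof
  interpret J: ideal J R by (rule J)
  have up: "transvection N (N.coord 0) (\<zero>, x) = elem_trans R M x" if "x \<in> carrier M" for x
    using that by (simp add: elem_trans_eq)
  have down: "transvection N (a \<odot>\<^bsub>dual R N\<^esub> N.coord (Suc i)) (B 0) \<in> H" if "i < n" "a \<in> J" for a i
  proof -
    let ?\<tau> = "a \<odot>\<^bsub>dual R M\<^esub> M.coord i"
    have \<tau>: "?\<tau> \<in> carrier (dual R M)"
      using that by (simp add: J.a_Hcarr M.dual_op_closed M.coord_dual)
    have "?\<tau> \<in> ideal_smult J (dual R M)"
      using that \<tau> by (auto simp: M.dual.ideal_smult_left_iff[OF J] M.dual_apply M.coord_closed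
        J.I_r_closed)
    moreover have "extend ?\<tau> = a \<odot>\<^bsub>dual R N\<^esub> N.coord (Suc i)"
      using that \<tau> by (intro N.dual_eqI extend_dual N.dual_op_closed N.coord_dual)
        (auto simp: J.a_Hcarr ring_plus_simps(1) extend_apply M.dual_apply N.dual_apply N_coord)
    ultimately show ?thesis
      using JH elem_trans_dual_eq[OF \<tau>] by auto
  qed
  fix h assume "h \<in> N.elementary J"
  then obtain a i j where h: "h = transvection N (a \<odot>\<^bsub>dual R N\<^esub> N.coord i) (B j)"
    and ij: "i < Suc n" "j < Suc n" "i \<noteq> j" and a: "a \<in> J"
    unfolding N.elementary_def by blast
  have aR: "a \<in> carrier R"
    using a by (rule J.a_Hcarr)
  consider j' where "i = 0" "j = Suc j'" "j' < n" | i' where "i = Suc i'" "j = 0" "i' < n"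
    | i' j' where "i = Suc i'" "j = Suc j'" "i' < n" "j' < n"
    using ij by (cases i; cases j) auto
  then show "h \<in> H"
  proof cases
    case 1
    have x: "a \<odot>\<^bsub>M\<^esub> b j' \<in> carrier M"
      using aR 1 M.basis_closed by simp
    have "a \<odot>\<^bsub>M\<^esub> b j' \<in> ideal_smult J M"
      using x a 1 by (auto simp: M.dual.ideal_smult_right_iff[OF J] M.dual_smult M.dual_closed aR
          M.basis_closed J.I_r_closed)
    moreover have "h = transvection N (N.coord 0) (a \<odot>\<^bsub>N\<^esub> B j)"
      unfolding h 1(1) using aR ij N.coord_dual N.basis_closed by (intro N.transvection_scale) auto
    then have "h = elem_trans R M (a \<odot>\<^bsub>M\<^esub> b j')"
      using aR 1 by (simp add: B_simps ring_plus_simps flip: up[OF x])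
    ultimately show ?thesis
      using JH by blast
  next
    case 2
    then show ?thesis
      using down a by (simp add: h)
  next
    case 3
    let ?t = "a \<odot>\<^bsub>dual R N\<^esub> N.coord i"
    have "transvection N (N.coord 0) (B j) \<in> G"
      using TG 3 up[of "b j'"] M.basis_closed by (auto simp: B_simps ideal_smult_carrier)
    moreover have "transvection N ?t (B 0) \<in> H"
      using down 3 a by simp
    ultimately have "transvection N (N.coord 0 (B 0) \<odot>\<^bsub>dual R N\<^esub> ?t) (B j) \<in> H"
      using 3 ij aR N.coord_dual N.basis_closed
      by (intro N.transvection_commutator_mem[OF H G conj])
        (auto simp: N.dual_op_closed N.dual_apply N.coord_basis)
    then show ?thesis
      using ij aR N.coord_dual
      by (simp add: h N.coord_basis N.dual_op_closed)
  qed
qed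

theorem ETrans_rel_eq:
  assumes I: "ideal I R"
  shows "ETrans_rel R I M = N.relative_elementary I"
proof -
  interpret Aut: group "Aut R N"
    by (rule N.Aut_group)
  let ?T = "elem_transvections (carrier R)" and ?S = "elem_transvections I"
  note oneideal = M.R.oneideal
  have T: "?T \<subseteq> carrier (Aut R N)"
    by (rule elem_transvections_in_Aut[OF oneideal])
  have "?S \<subseteq> ?T"
    using M.dual.ideal_smult_right_iff[OF I] M.dual.ideal_smult_left_iff[OF I]
    unfolding ideal_smult_carrier by blast
  then have S: "?S \<subseteq> generate (Aut R N) ?T"
    by (blast intro: generate.incl)
  note T' = N.elementary_in_Aut[OF order_refl] and S' = N.elementary_subset_generate[OF I]
  note gen = Aut.generate_is_subgroup[OF T] and gen' = Aut.generate_is_subgroup[OF T']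
  have "ETrans_rel R I M = relative_closure (Aut R N) ?T ?S"
    by (simp add: ETrans_rel_def ETrans_def ETrans_gen_def relative_closure_def ideal_smult_carrier)
  also have "\<dots> = N.relative_elementary I"
  proof (rule Aut.relative_closure_eqI[OF T S T' S'])
    show "?T \<subseteq> generate (Aut R N) (N.elementary (carrier R))"
      by (intro elem_transvections_subset gen' oneideal) (auto intro: generate.incl)
    show "N.elementary (carrier R) \<subseteq> generate (Aut R N) ?T"
      using gen by (intro elementary_subset[of _ "generate (Aut R N) ?T"] oneideal)
        (auto intro: generate.incl subgroup.m_closed subgroup.m_inv_closed)
    show "?S \<subseteq> N.relative_elementary I"
      using Aut.relative_closure_incl[OF T' S']
      by (intro elem_transvections_subset Aut.relative_closure_subgroup[OF T' S'] I)
    show "N.elementary I \<subseteq> relative_closure (Aut R N) ?T ?S"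
      using Aut.relative_closure_incl[OF T S] Aut.relative_closure_conj[OF T S]
      by (intro elementary_subset[of _ "generate (Aut R N) ?T"] Aut.relative_closure_subgroup[OF T S]
          gen I) (auto intro: generate.incl)
  qed
  finally show ?thesis .
qed

end

theorem lemma4p5:
  fixes R :: "('a, 'r) ring_scheme" and M :: "('a, 'b, 'm) module_scheme"
    and I :: "'a set" and n :: nat and b :: "nat \<Rightarrow> 'b"
  assumes "cring R" and "ideal I R" and "Module.module R M"
    and "n \<ge> 2" and "free_basis R M n b"
  shows "ETrans_rel R I M = Trans R I (ring_plus R M) \<and>
    matrix_of R (ring_plus R M) (n + 1) (ring_plus_basis R M b) ` Trans R I (ring_plus R M)
      = Elem_rel R I (n + 1)"
proof -
  interpret ring_plus_free R M n b
    using assms(3,5) by (simp add: ring_plus_free_def free_module_def free_module_axioms_def)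
  have "Trans R I N = N.relative_elementary I"
    using assms(2,4) by (intro N.Trans_eq_relative_elementary) auto
  then show ?thesis
    using ETrans_rel_eq[OF assms(2)] N.to_mat_relative_elementary[OF assms(2)] by simp
qed

end
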